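(* Let $(k_n)_{n \in \mathbb{N}}$ and $(s_n)_{n \in \mathbb{N}}$ be sequences as fixed in the context, with associated relations $\mathbb{G}_{0,k}$ on $2^{\mathbb{N}}$. Suppose that $X$ is a Hausdorff space and $(G_{i,j})_{i,j \in \mathbb{N}}$ is a sequence of analytic graphs on $X$ that is increasing in $j$ (i.e., $G_{i,j} \subseteq G_{i,j+1}$ for all $i,j \in \mathbb{N}$). Then exactly one of the following holds: (1) There are Borel sets $B_n \subseteq X$ such that $X = \bigcup_{n \in \mathbb{N}} B_n$ and $\forall n \in \mathbb{N}\ \exists i \in \mathbb{N}\ \forall j \in \mathbb{N}\ \chi_B(G_{i,j} \restriction B_n) \le \aleph_0$. (2) There exist a function $f \colon \mathbb{N} \to \mathbb{N}$ and a continuous map $\phi \colon 2^{\mathbb{N}} \to X$ that is a homomorphism from $(\mathbb{G}_{0,k})_{k \in \mathbb{N}}$ to $(G_{k,f(k)})_{k \in \mathbb{N}}$.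
   Context: Fixed sequences: $k_n \in \mathbb{N}$ are such that $k_0 = 0$, $k_{n+1} \le \max\{k_m : m \le n\} + 1$ for all $n$, and every $k \in \mathbb{N}$ equals $k_n$ for infinitely many $n$; and $s_n \in 2^n$ (binary sequences of length $n$) are such that for every $k \in \mathbb{N}$ and every finite binary sequence $s \in 2^{<\mathbb{N}}$ there is $n \in \mathbb{N}$ with $k = k_n$ and $s \sqsubseteq s_n$ ($s_n$ extends $s$). For $s \in 2^{<\mathbb{N}}$, $\mathbb{G}_s = \{(s {}^{\frown} (0) {}^{\frown} c,\ s {}^{\frown} (1) {}^{\frown} c) : c \in 2^{\mathbb{N}}\}$, where ${}^{\frown}$ is concatenation. For $k \in \mathbb{N}$, $\mathbb{G}_{0,k} = \bigcup\{\mathbb{G}_{s_n} : n \in \mathbb{N},\ k_n = k\}$. A subset of a Hausdorff space is analytic if it is empty or a continuous image of $\mathbb{N}^{\mathbb{N}}$. A graph on $X$ is an irreflexive symmetric set $G \subseteq X \times X$; it is analytic if it is an analytic subset of $X \times X$. $G \restriction B = G \cap (B \times B)$, viewed as a graph on $B$. For a graph $G$ on $B$, $\chi_B(G) \le \aleph_0$ means that there is a Borel map $c \colon B \to \mathbb{N}$ such that $c(x) \ne c(y)$ whenever $(x,y) \in G$. A homomorphism from a sequence $(R_i)_{i \in I}$ of binary relations on $Y$ to a sequence $(S_i)_{i \in I}$ of binary relations on $X$ is a map $\phi \colon Y \to X$ such that $w \mathrel{R_i} x \implies \phi(w) \mathrel{S_i} \phi(x)$ for all $i \in I$ and $w,x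 \in Y$. *)

theory Defs
  imports
    "HOL-Analysis.Analysis"
    "HOL-Library.Sublist"
    "HOL-Library.Omega_Words_Fun"
begin

text \<open>
  Finite binary sequences are boolean lists; \<open>2\<^sup>\<nat>\<close> and \<open>\<nat>\<^sup>\<nat>\<close> are the types
  \<open>nat \<Rightarrow> bool\<close> and \<open>nat \<Rightarrow> nat\<close>, whose type-class topologies are the product
  topologies of the discrete topologies on \<open>bool\<close> and \<open>nat\<close>. The operator \<open>\<frown>\<close> from
  \<open>Omega_Words_Fun\<close> concatenates a list with an infinite sequence. Note that \<open>Sublist.prefix\<close>
  has to be qualified, since \<open>Omega_Words_Fun\<close> introduces another \<open>prefix\<close>.
\<close>

definition GG_node :: "bool list \<Rightarrow> ((nat \<Rightarrow> bool) \<times> (nat \<Rightarrow> bool)) set" where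
  "GG_node s = {((s @ [False]) \<frown> c, (s @ [True]) \<frown> c) | c. True}"

definition GG0 ::
    "(nat \<Rightarrow> nat) \<Rightarrow> (nat \<Rightarrow> bool list) \<Rightarrow> nat \<Rightarrow> ((nat \<Rightarrow> bool) \<times> (nat \<Rightarrow> bool)) set" where
  "GG0 k s j = (\<Union>n\<in>{n. k n = j}. GG_node (s n))"

definition analytic_in :: "'a topology \<Rightarrow> 'a set \<Rightarrow> bool" where
  "analytic_in T A \<longleftrightarrow>
     A = {} \<or> (\<exists>g :: (nat \<Rightarrow> nat) \<Rightarrow> 'a. continuous_map euclidean T g \<and> range g = A)"

definition graph_on :: "'a set \<Rightarrow> ('a \<times> 'a) set \<Rightarrow> bool" where
  "graph_on V G \<longleftrightarrow> G \<subseteq> V \<times> V \<and> irrefl G \<and> sym G"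

definition analytic_graph :: "'a topology \<Rightarrow> ('a \<times> 'a) set \<Rightarrow> bool" where
  "analytic_graph X G \<longleftrightarrow> graph_on (topspace X) G \<and> analytic_in (prod_topology X X) G"

definition borel_of :: "'a topology \<Rightarrow> 'a measure" where
  "borel_of T = sigma (topspace T) {U. openin T U}"

definition restrict_graph :: "('a \<times> 'a) set \<Rightarrow> 'a set \<Rightarrow> ('a \<times> 'a) set" where
  "restrict_graph G B = G \<inter> (B \<times> B)"

text \<open>The Borel chromatic number of the graph \<open>G\<close> on the space \<open>T\<close> is at most \<open>\<aleph>\<^sub>0\<close>.\<close>

definition borel_chromatic_le_aleph0 :: "'a topology \<Rightarrow> ('a \<times> 'a) set \<Rightarrow> bool" where
  "borel_chromatic_le_aleph0 T G \<longleftrightarrow>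
     (\<exists>c :: 'a \<Rightarrow> nat. c \<in> borel_measurable (borel_of T) \<and> (\<forall>(x, y)\<in>G. c x \<noteq> c y))"

definition seq_homomorphism ::
    "('a \<Rightarrow> 'b) \<Rightarrow> ('i \<Rightarrow> ('a \<times> 'a) set) \<Rightarrow> ('i \<Rightarrow> ('b \<times> 'b) set) \<Rightarrow> bool" where
  "seq_homomorphism \<phi> R S \<longleftrightarrow> (\<forall>i w x. (w, x) \<in> R i \<longrightarrow> (\<phi> w, \<phi> x) \<in> S i)"

end

theory Submission
  imports Defs
begin

text \<open>
  The alternatives exclude each other by Baire category: a Borel set and a colour class that is
  nonmeager along \<open>\<phi>\<close> is comeager in the cylinder of some \<open>s n\<close> with \<open>k n\<close> the index
  belonging to that Borel set, and flipping the bit after \<open>s n\<close> produces a monochromatic edge.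

  For existence, a stage \<open>n\<close> configuration codes a family of vertices indexed by \<open>2\<^sup>n\<close> together
  with witnesses in \<open>\<nat>\<^sup>\<nat>\<close> for the edges between them. For \<open>J i\<close> either \<open>{f i}\<close> (once \<open>f i\<close> is
  chosen) or all of \<open>\<nat>\<close>, let the null sets be the \<open>\<sigma>\<close>-ideal generated by the Borel sets that
  have, for some \<open>i\<close>, countable Borel chromatic number for every \<open>G i j\<close> with \<open>j \<in> J i\<close>. A set of
  configurations is small if some null set meets each of its members. If the first alternative
  fails, the set of all stage 0 configurations is not small, and a set that is not small can be
  prolonged to the next stage: a value \<open>f (k n)\<close> can be fixed since \<open>G i j\<close> increases with \<open>j\<close>,
  two configurations can be joined by an edge at \<open>s n\<close> since independent analytic sets have
  independent Borel hulls, and finitely many coordinates can be fixed since small sets form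
  a \<open>\<sigma>\<close>-ideal. The configurations converge along branches to the continuous homomorphism.
\<close>

section \<open>Borel sets\<close>

lemma space_borel_of: "space (borel_of X) = topspace X"
  unfolding borel_of_def using openin_subset by (auto intro!: space_measure_of)

lemma sets_borel_of: "sets (borel_of X) = sigma_sets (topspace X) {U. openin X U}"
  unfolding borel_of_def using openin_subset by (auto intro!: sets_measure_of)

lemma borel_of_openin: "openin X U \<Longrightarrow> U \<in> sets (borel_of X)"
  unfolding sets_borel_of by (simp add: sigma_sets.Basic)

lemma borel_of_topspace: "topspace X \<in> sets (borel_of X)"
  by (simp add: borel_of_openin)

lemma borel_of_Diff_topspace: "B \<in> sets (borel_of X) \<Longrightarrow> topspace X - B \<in> sets (borel_of X)"
  using borel_of_topspace by (rule sets.Diff)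

lemma vimage_borel_of:
  fixes h :: "'b::topological_space \<Rightarrow> 'a"
  assumes h: "continuous_map euclidean X h" and B: "B \<in> sets (borel_of X)"
  shows "h -` B \<in> sets borel"
  using B unfolding sets_borel_of
proof induction
  case (Basic U)
  then have "open (h -` U)"
    using h by (auto simp: continuous_map_def vimage_def)
  then show ?case by simp
next
  case Empty
  then show ?case by simp
next
  case (Compl A)
  have "h -` (topspace X - A) = - (h -` A)"
    using h by (auto simp: continuous_map_def)
  then show ?case using Compl by auto
next
  case (Union A)
  then show ?case by (auto simp: vimage_Union)
qed

text \<open>As \<open>B\<close> is itself Borel, relatively open subsets of it are Borel in
  \<open>X\<close>; this brings colour classes on \<open>B\<close> back to \<open>X\<close>.\<close>

lemma borel_of_subtopology_subset:
  assumes B: "B \<in> sets (borel_of X)" and A: "A \<in> sets (borel_of (subtopology X B))"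
  shows "A \<in> sets (borel_of X)"
proof -
  have top: "topspace (subtopology X B) = B"
    using sets.sets_into_space[OF B] by (auto simp: space_borel_of)
  show ?thesis
    using A unfolding sets_borel_of[of "subtopology X B"] top
  proof induction
    case (Basic U)
    then show ?case using B by (auto simp: openin_subtopology borel_of_openin)
  qed (use B in auto)
qed

lemma borel_of_Int_subtopology:
  assumes A: "A \<in> sets (borel_of X)"
  shows "A \<inter> B \<in> sets (borel_of (subtopology X B))"
  using A unfolding sets_borel_of[of X]
proof induction
  case (Basic U)
  then show ?case by (auto simp: openin_subtopology intro!: borel_of_openin)
next
  case (Compl A)
  have "(topspace X - A) \<inter> B = topspace (subtopology X B) - (A \<inter> B)"
    by auto
  then show ?case using Compl borel_of_Diff_topspace by metis
next
  case (Union A)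
  then show ?case by (auto simp: Int_Union2 UN_extend_simps simp del: UN_simps)
qed auto

section \<open>Cylinders as a base of sequence spaces\<close>

lemma open_cylinder:
  fixes x :: "nat \<Rightarrow> 'b::{discrete_topology}"
  shows "open {y. \<forall>l<n. y l = x l}"
proof -
  have "open {y :: nat \<Rightarrow> 'b. y l = x l}" for l
  proof -
    have "open ((\<lambda>y :: nat \<Rightarrow> 'b. y l) -` {x l})"
      by (intro open_vimage open_discrete continuous_on_product_coordinates)
    then show ?thesis by (simp add: vimage_def)
  qed
  then have "open (\<Inter>l\<in>{..<n}. {y. y l = x l})" by blast
  moreover have "(\<Inter>l\<in>{..<n}. {y. y l = x l}) = {y. \<forall>l<n. y l = x l}" by auto
  ultimately show ?thesis by simp
qed

text \<open>A basic open set of the product restricts only finitely many coordinates, and a cylinder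
  longer than all of these fits into it.\<close>

lemma open_contains_cylinder:
  fixes x :: "nat \<Rightarrow> 'b::{discrete_topology}"
  assumes "open U" "x \<in> U"
  obtains n where "{y. \<forall>l<n. y l = x l} \<subseteq> U"
proof -
  have "openin (product_topology (\<lambda>i. euclidean) UNIV) U"
    using \<open>open U\<close> by (simp add: open_fun_def)
  then obtain V where V: "finite {i. V i \<noteq> UNIV}" "x \<in> (\<Pi>\<^sub>E i\<in>UNIV. V i)" "(\<Pi>\<^sub>E i\<in>UNIV. V i) \<subseteq> U"
    using \<open>x \<in> U\<close> unfolding openin_product_topology_alt by fastforce
  from V(1) obtain n where n: "\<And>i. V i \<noteq> UNIV \<Longrightarrow> i < n"
    by (metis (mono_tags, lifting) finite_nat_set_iff_bounded mem_Collect_eq)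
  have "{y. \<forall>l<n. y l = x l} \<subseteq> U"
  proof
    fix y assume y: "y \<in> {y. \<forall>l<n. y l = x l}"
    have "y i \<in> V i" for i
      using n[of i] y V(2) by (cases "V i = UNIV") (auto simp: PiE_iff)
    then show "y \<in> U" using V(3) by (auto simp: PiE_iff)
  qed
  then show ?thesis by (rule that)
qed

section \<open>Analytic sets and Lusin separation\<close>

text \<open>Closed subsets of \<open>\<nat>\<^sup>\<nat> \<times> \<nat>\<^sup>\<nat>\<close> absorb countable unions and intersections of their
  projections, because a countable family of witnesses can be coded by one point of \<open>\<nat>\<^sup>\<nat>\<close>.\<close>

definition closed_projection :: "(nat \<Rightarrow> nat) set \<Rightarrow> bool" where
  "closed_projection E \<longleftrightarrow> (\<exists>C :: ((nat \<Rightarrow> nat) \<times> (nat \<Rightarrow> nat)) set. closed C \<and> E = fst ` C)"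

lemma closed_projection_closed: "closed E \<Longrightarrow> closed_projection E"
  unfolding closed_projection_def
  by (intro exI[of _ "E \<times> UNIV"]) (auto intro: closed_Times)

lemma closed_projection_UN:
  assumes "\<And>n::nat. closed_projection (E n)"
  shows "closed_projection (\<Union>n. E n)"
proof -
  obtain C :: "nat \<Rightarrow> ((nat \<Rightarrow> nat) \<times> (nat \<Rightarrow> nat)) set"
    where C: "\<And>n. closed (C n)" "\<And>n. E n = fst ` C n"
    using assms unfolding closed_projection_def by metis
  \<comment> \<open>Coordinate 0 of the witness names the set \<open>C n\<close> to be met, and the
    shifted rest is the witness for it.\<close>
  let ?q = "\<lambda>z. (fst z, \<lambda>l. snd z (Suc l)) :: (nat \<Rightarrow> nat) \<times> (nat \<Rightarrow> nat)"
  let ?D = "\<Inter>n. {z :: (nat \<Rightarrow> nat) \<times> (nat \<Rightarrow> nat). snd z 0 \<noteq> n} \<union> ?q -` C n"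
  have snd_i: "continuous_on UNIV (\<lambda>z :: (nat \<Rightarrow> nat) \<times> (nat \<Rightarrow> nat). snd z i)" for i
    by (rule continuous_on_product_then_coordinatewise) (intro continuous_intros)
  have q: "continuous_on UNIV ?q"
    by (intro continuous_on_Pair continuous_on_fst continuous_on_id
        continuous_on_coordinatewise_then_product snd_i)
  have "closed {z :: (nat \<Rightarrow> nat) \<times> (nat \<Rightarrow> nat). snd z 0 \<noteq> n}" for n
  proof -
    have "closed ((\<lambda>z :: (nat \<Rightarrow> nat) \<times> (nat \<Rightarrow> nat). snd z 0) -` (- {n}))"
      by (intro closed_vimage snd_i) (simp add: closed_def open_discrete)
    then show ?thesis by (simp add: vimage_def)
  qed
  then have "closed ?D"
    by (intro closed_INT ballI closed_Un closed_vimage q C)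
  moreover have "(\<Union>n. E n) = fst ` ?D"
  proof (intro equalityI subsetI)
    fix x assume "x \<in> (\<Union>n. E n)"
    then obtain n y where "(x, y) \<in> C n" using C(2) by fastforce
    then have "(x, \<lambda>l. case l of 0 \<Rightarrow> n | Suc l \<Rightarrow> y l) \<in> ?D" by auto
    then show "x \<in> fst ` ?D" by (rule image_eqI[rotated]) simp
  next
    fix x assume "x \<in> fst ` ?D"
    then obtain y where "(x, y) \<in> ?D" by auto
    then have "(x, \<lambda>l. y (Suc l)) \<in> C (y 0)" by auto
    then show "x \<in> (\<Union>n. E n)" by (force simp: C(2))
  qed
  ultimately show ?thesis unfolding closed_projection_def by blast
qed

lemma closed_projection_INT:
  assumes "\<And>n::nat. closed_projection (E n)"
  shows "closed_projection (\<Inter>n. E n)"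
proof -
  obtain C :: "nat \<Rightarrow> ((nat \<Rightarrow> nat) \<times> (nat \<Rightarrow> nat)) set"
    where C: "\<And>n. closed (C n)" "\<And>n. E n = fst ` C n"
    using assms unfolding closed_projection_def by metis
  \<comment> \<open>Row \<open>n\<close> of the witness, read through the pairing
    \<open>prod_encode\<close>, must be a witness for \<open>C n\<close>.\<close>
  let ?q = "\<lambda>n z. (fst z, \<lambda>l. snd z (prod_encode (n, l))) :: (nat \<Rightarrow> nat) \<times> (nat \<Rightarrow> nat)"
  let ?D = "\<Inter>n. ?q n -` C n"
  have snd_i: "continuous_on UNIV (\<lambda>z :: (nat \<Rightarrow> nat) \<times> (nat \<Rightarrow> nat). snd z i)" for i
    by (rule continuous_on_product_then_coordinatewise) (intro continuous_intros)
  have q: "continuous_on UNIV (?q n)" for n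
    by (intro continuous_on_Pair continuous_on_fst continuous_on_id
        continuous_on_coordinatewise_then_product snd_i)
  have "closed ?D"
    by (intro closed_INT ballI closed_vimage q C)
  moreover have "(\<Inter>n. E n) = fst ` ?D"
  proof (intro equalityI subsetI)
    fix x assume "x \<in> (\<Inter>n. E n)"
    then have "\<forall>n. \<exists>y. (x, y) \<in> C n" using C(2) by fastforce
    then obtain y where "\<And>n. (x, y n) \<in> C n" by metis
    then have "(x, \<lambda>l. case prod_decode l of (n, l) \<Rightarrow> y n l) \<in> ?D" by auto
    then show "x \<in> fst ` ?D" by (rule image_eqI[rotated]) simp
  next
    fix x assume "x \<in> fst ` ?D"
    then obtain y where "(x, y) \<in> ?D" by auto
    then have "(x, \<lambda>l. y (prod_encode (n, l))) \<in> C n" for n by auto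
    then show "x \<in> (\<Inter>n. E n)" by (force simp: C(2))
  qed
  ultimately show ?thesis unfolding closed_projection_def by blast
qed

text \<open>The induction carries \<open>E\<close> and \<open>- E\<close> together, so that
  complements merely swap the two claims and unions use both preceding lemmas. The generators
  constrain a single coordinate and are therefore clopen.\<close>

lemma closed_projection_borel:
  assumes "E \<in> sets (borel :: (nat \<Rightarrow> nat) measure)"
  shows "closed_projection E"
proof -
  let ?G = "{{f::nat\<Rightarrow>nat. f i \<in> A} |i A. i \<in> UNIV \<and> A \<in> sets borel}"
  have "sets (PiM UNIV (\<lambda>i::nat. borel :: nat measure)) = sigma_sets UNIV ?G"
    using sets_PiM_single[of UNIV "\<lambda>i::nat. borel :: nat measure"] by simp
  then have "E \<in> sigma_sets UNIV ?G"
    using assms sets_PiM_equal_borel by blast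
  then have "closed_projection E \<and> closed_projection (- E)"
  proof induction
    case (Basic a)
    then obtain i A where a: "a = {f. f i \<in> A}" by auto
    have "closed ((\<lambda>f::nat\<Rightarrow>nat. f i) -` B)" for B
      by (intro closed_vimage continuous_on_product_coordinates) (simp add: closed_def open_discrete)
    from closed_projection_closed[OF this[of A]] closed_projection_closed[OF this[of "- A"]]
    show ?case by (simp add: a vimage_def Collect_neg_eq)
  next
    case Empty
    then show ?case by (simp add: closed_projection_closed)
  next
    case (Compl a)
    then show ?case by (simp add: Compl_eq_Diff_UNIV[symmetric])
  next
    case (Union a)
    then show ?case by (auto intro: closed_projection_UN closed_projection_INT)
  qed
  then show ?thesis ..
qed

section \<open>Separation of disjoint analytic sets by Borel sets\<close>

definition borel_separated :: "'a topology \<Rightarrow> 'a set \<Rightarrow> 'a set \<Rightarrow> bool" where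
  "borel_separated X A A' \<longleftrightarrow> (\<exists>B\<in>sets (borel_of X). A \<subseteq> B \<and> B \<inter> A' = {})"

text \<open>Pairwise separators combine to \<open>\<Union>i. \<Inter>j. B i j\<close>. The use is
  contrapositive: if two unions cannot be separated, neither can some pair of their pieces.\<close>

lemma borel_separated_UN:
  assumes "\<And>(i::nat) (j::nat). borel_separated X (A i) (A' j)"
  shows "borel_separated X (\<Union>i. A i) (\<Union>j. A' j)"
proof -
  obtain B where B: "\<And>i j. B i j \<in> sets (borel_of X)" "\<And>i j. A i \<subseteq> B i j" "\<And>i j. B i j \<inter> A' j = {}"
    using assms unfolding borel_separated_def by metis
  have "(\<Union>i. \<Inter>j. B i j) \<in> sets (borel_of X)"
    using B(1) by (intro sets.countable_UN image_subsetI sets.countable_INT) auto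
  moreover have "(\<Union>i. A i) \<subseteq> (\<Union>i. \<Inter>j. B i j)"
    using B(2) by (intro UN_mono INT_greatest) auto
  moreover have "(\<Union>i. \<Inter>j. B i j) \<inter> (\<Union>j. A' j) = {}"
  proof (intro equals0I)
    fix x assume "x \<in> (\<Union>i. \<Inter>j. B i j) \<inter> (\<Union>j. A' j)"
    then obtain i j where "x \<in> B i j" "x \<in> A' j" by auto
    with B(3)[of i j] show False by blast
  qed
  ultimately show ?thesis
    unfolding borel_separated_def by (intro bexI[of _ "\<Union>i. \<Inter>j. B i j"] conjI)
qed

text \<open>If the two images were not separated, neither would be those of some pair of smaller
  cylinders; the limits of the resulting nested cylinders have different values, which can
  be separated by open sets.\<close>

lemma borel_separated_closed_images:
  fixes h h' :: "(nat \<Rightarrow> nat) \<Rightarrow> 'a"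
  assumes X: "Hausdorff_space X"
    and h: "continuous_map euclidean X h" and h': "continuous_map euclidean X h'"
    and C: "closed C" and C': "closed C'" and disj: "h ` C \<inter> h' ` C' = {}"
  shows "borel_separated X (h ` C) (h' ` C')"
proof (rule ccontr)
  assume contra: "\<not> borel_separated X (h ` C) (h' ` C')"
  define cyl :: "nat \<Rightarrow> (nat \<Rightarrow> nat) \<Rightarrow> (nat \<Rightarrow> nat) set" where "cyl n x = {y. \<forall>l<n. y l = x l}" for n x
  \<comment> \<open>A state is a pair of points of which only the first \<open>n\<close> coordinates
    count: \<open>P\<close> says that the images of the two cylinders are still inseparable,
    \<open>Q\<close> that the next state keeps these coordinates.\<close>
  define P where "P n p \<longleftrightarrow> \<not> borel_separated X (h ` (C \<inter> cyl n (fst p))) (h' ` (C' \<inter> cyl n (snd p)))"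
    for n p
  define Q where "Q n p p' \<longleftrightarrow> (\<forall>l<n. fst p' l = fst p l \<and> snd p' l = snd p l)"
    for n :: nat and p p' :: "(nat \<Rightarrow> nat) \<times> (nat \<Rightarrow> nat)"
  have split: "cyl n x = (\<Union>a. cyl (Suc n) (x(n := a)))" for n x
    by (auto simp: cyl_def less_Suc_eq)
  have "\<exists>p. \<forall>n. P n (p n) \<and> Q n (p n) (p (Suc n))"
  proof (rule dependent_nat_choice)
    show "\<exists>p. P 0 p" using contra by (auto simp: P_def cyl_def)
  next
    fix p n assume p: "P n p"
    have "h ` (C \<inter> cyl n (fst p)) = (\<Union>a. h ` (C \<inter> cyl (Suc n) ((fst p)(n := a))))"
      "h' ` (C' \<inter> cyl n (snd p)) = (\<Union>a. h' ` (C' \<inter> cyl (Suc n) ((snd p)(n := a))))"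
      by (auto simp: split[of n])
    with p have "\<not> borel_separated X (\<Union>a. h ` (C \<inter> cyl (Suc n) ((fst p)(n := a))))
        (\<Union>b. h' ` (C' \<inter> cyl (Suc n) ((snd p)(n := b))))"
      by (simp add: P_def)
    then have "\<exists>a b. \<not> borel_separated X (h ` (C \<inter> cyl (Suc n) ((fst p)(n := a))))
        (h' ` (C' \<inter> cyl (Suc n) ((snd p)(n := b))))"
      by (rule contrapos_np) (intro borel_separated_UN, simp)
    then obtain a b where "\<not> borel_separated X (h ` (C \<inter> cyl (Suc n) ((fst p)(n := a))))
        (h' ` (C' \<inter> cyl (Suc n) ((snd p)(n := b))))"
      by (elim exE)
    then show "\<exists>p'. P (Suc n) p' \<and> Q n p p'"
      by (intro exI[of _ "((fst p)(n := a), (snd p)(n := b))"]) (auto simp: P_def Q_def)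
  qed
  then obtain p where p: "\<And>n. P n (p n)" "\<And>n. Q n (p n) (p (Suc n))" by auto
  have stable: "fst (p (n + d)) l = fst (p n) l \<and> snd (p (n + d)) l = snd (p n) l" if "l < n" for n d l
    by (induction d) (use p(2) that in \<open>auto simp: Q_def\<close>)
  define x where "x l = fst (p (Suc l)) l" for l
  define y where "y l = snd (p (Suc l)) l" for l
  have "fst (p n) l = x l \<and> snd (p n) l = y l" if "l < n" for n l
    using stable[of l "Suc l" "n - Suc l"] that by (simp add: x_def y_def)
  then have "cyl n (fst (p n)) = cyl n x" "cyl n (snd (p n)) = cyl n y" for n
    by (auto simp: cyl_def)
  with p(1) have nsep: "\<not> borel_separated X (h ` (C \<inter> cyl n x)) (h' ` (C' \<inter> cyl n y))" for n
    by (simp add: P_def)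
  \<comment> \<open>An empty image would be separated by the empty set or by the whole
    space.\<close>
  have ne: "C \<inter> cyl n x \<noteq> {}" "C' \<inter> cyl n y \<noteq> {}" for n
    using nsep[of n] borel_of_topspace[of X] h
    by (auto simp: borel_separated_def continuous_map_def)
  have "x \<in> C"
  proof (rule ccontr)
    assume "x \<notin> C"
    with C obtain n where "cyl n x \<subseteq> - C"
      using open_contains_cylinder[of "- C" x] by (auto simp: cyl_def closed_def)
    with ne(1)[of n] show False by blast
  qed
  moreover have "y \<in> C'"
  proof (rule ccontr)
    assume "y \<notin> C'"
    with C' obtain n where "cyl n y \<subseteq> - C'"
      using open_contains_cylinder[of "- C'" y] by (auto simp: cyl_def closed_def)
    with ne(2)[of n] show False by blast
  qed
  ultimately have "h x \<noteq> h' y" using disj by blast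
  moreover have "h x \<in> topspace X" "h' y \<in> topspace X"
    using h h' by (auto simp: continuous_map_def)
  ultimately obtain U V where UV: "openin X U" "openin X V" "h x \<in> U" "h' y \<in> V" "disjnt U V"
    using X unfolding Hausdorff_space_def by metis
  have "open (h -` U)" "open (h' -` V)"
    using h h' UV by (auto simp: continuous_map_def vimage_def)
  have "x \<in> h -` U" "y \<in> h' -` V" using UV by simp_all
  obtain n where n: "cyl n x \<subseteq> h -` U"
    using open_contains_cylinder[OF \<open>open (h -` U)\<close> \<open>x \<in> h -` U\<close>] unfolding cyl_def by blast
  obtain n' where n': "cyl n' y \<subseteq> h' -` V"
    using open_contains_cylinder[OF \<open>open (h' -` V)\<close> \<open>y \<in> h' -` V\<close>] unfolding cyl_def by blast
  let ?m = "max n n'"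
  have "cyl ?m x \<subseteq> cyl n x" "cyl ?m y \<subseteq> cyl n' y"
    by (auto simp: cyl_def)
  then have "h ` (C \<inter> cyl ?m x) \<subseteq> U" "h' ` (C' \<inter> cyl ?m y) \<subseteq> V"
    using n n' by blast+
  then have "borel_separated X (h ` (C \<inter> cyl ?m x)) (h' ` (C' \<inter> cyl ?m y))"
    unfolding borel_separated_def
    using UV(5) borel_of_openin[OF UV(1)] by (intro bexI[of _ U]) (auto simp: disjnt_def)
  with nsep show False by blast
qed

definition suslin :: "'a topology \<Rightarrow> 'a set \<Rightarrow> bool" where
  "suslin X A \<longleftrightarrow> (\<exists>(h :: (nat \<Rightarrow> nat) \<Rightarrow> 'a) E. continuous_map euclidean X h \<and>
     E \<in> sets borel \<and> A = h ` E)"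

lemma continuous_on_reindex:
  fixes r :: "'j \<Rightarrow> 'i"
  shows "continuous_on UNIV (\<lambda>z :: 'i \<Rightarrow> 'c::topological_space. \<lambda>l. z (r l))"
  by (intro continuous_on_coordinatewise_then_product) simp

text \<open>A Borel set of parameters is the projection of a closed set of pairs, and a pair of
  sequences is coded by the even and odd coordinates of one sequence.\<close>

lemma suslin_closed_image:
  assumes "suslin X A"
  obtains h :: "(nat \<Rightarrow> nat) \<Rightarrow> 'a" and C
  where "continuous_map euclidean X h" "closed C" "A = h ` C"
proof -
  obtain h :: "(nat \<Rightarrow> nat) \<Rightarrow> 'a" and E where h: "continuous_map euclidean X h"
    and E: "E \<in> sets borel" "A = h ` E"
    using assms unfolding suslin_def by auto
  obtain C :: "((nat \<Rightarrow> nat) \<times> (nat \<Rightarrow> nat)) set" where C: "closed C" "E = fst ` C"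
    using closed_projection_borel[OF E(1)] by (auto simp: closed_projection_def)
  let ?e = "\<lambda>z :: nat \<Rightarrow> nat. \<lambda>l. z (2 * l)"
  let ?o = "\<lambda>z :: nat \<Rightarrow> nat. \<lambda>l. z (2 * l + 1)"
  let ?q = "\<lambda>z. (?e z, ?o z)"
  show thesis
  proof
    show "continuous_map euclidean X (h \<circ> ?e)"
      by (rule continuous_map_compose[OF _ h]) (simp add: continuous_on_reindex)
    show "closed (?q -` C)"
      by (intro closed_vimage C continuous_on_Pair continuous_on_reindex)
    have "surj ?q"
    proof (rule surjI)
      show "?q (\<lambda>l. if even l then fst p (l div 2) else snd p (l div 2)) = p" for p
        by (simp add: prod_eq_iff)
    qed
    then have "?q ` (?q -` C) = C" by (rule surj_image_vimage_eq)
    then have "E = fst ` ?q ` (?q -` C)" using C(2) by simp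
    then show "A = (h \<circ> ?e) ` (?q -` C)" by (simp only: E(2) image_image o_def fst_conv)
  qed
qed

lemma Lusin_separation:
  assumes "Hausdorff_space X" "suslin X A" "suslin X A'" "A \<inter> A' = {}"
  shows "borel_separated X A A'"
proof -
  from \<open>suslin X A\<close> obtain h :: "(nat \<Rightarrow> nat) \<Rightarrow> 'a" and C
    where h: "continuous_map euclidean X h" "closed C" "A = h ` C"
    by (rule suslin_closed_image)
  from \<open>suslin X A'\<close> obtain h' :: "(nat \<Rightarrow> nat) \<Rightarrow> 'a" and C'
    where h': "continuous_map euclidean X h'" "closed C'" "A' = h' ` C'"
    by (rule suslin_closed_image)
  show ?thesis
    using borel_separated_closed_images[OF assms(1) h(1) h'(1) h(2) h'(2)] assms(4) h(3) h'(3)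
    by simp
qed

text \<open>Lusin separation applies twice: \<open>B0\<close> separates \<open>A\<close> from its
  neighbours, then \<open>B1\<close> separates \<open>A\<close> from the points that send an edge
  into \<open>B0\<close>. An edge inside \<open>B0 \<inter> B1\<close> would start at a point of
  \<open>B1\<close> of the latter kind.\<close>

lemma independent_Borel_hull:
  fixes g :: "(nat \<Rightarrow> nat) \<Rightarrow> 'a \<times> 'a"
  assumes X: "Hausdorff_space X" and g: "continuous_map euclidean (prod_topology X X) g"
    and A: "suslin X A" and indep: "restrict_graph (range g) A = {}"
  obtains B where "B \<in> sets (borel_of X)" "A \<subseteq> B" "restrict_graph (range g) B = {}"
proof -
  have g1: "continuous_map euclidean X (fst \<circ> g)" and g2: "continuous_map euclidean X (snd \<circ> g)"
    using g by (simp_all add: continuous_map_pairwise)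
  obtain h :: "(nat \<Rightarrow> nat) \<Rightarrow> 'a" and E where h: "continuous_map euclidean X h"
    and E: "E \<in> sets borel" "A = h ` E"
    using A unfolding suslin_def by auto
  \<comment> \<open>Even coordinates code an edge, odd ones a parameter for a point of
    \<open>A\<close>; \<open>?F\<close> below says that the edge starts at that point.\<close>
  let ?e = "\<lambda>z :: nat \<Rightarrow> nat. \<lambda>l. z (2 * l)"
  let ?o = "\<lambda>z :: nat \<Rightarrow> nat. \<lambda>l. z (2 * l + 1)"
  let ?N = "{y. \<exists>x\<in>A. (x, y) \<in> range g}"
  have ge: "continuous_map euclidean X ((fst \<circ> g) \<circ> ?e)"
    "continuous_map euclidean X ((snd \<circ> g) \<circ> ?e)" "continuous_map euclidean X (h \<circ> ?o)"
    by (rule continuous_map_compose[rotated]; (rule g1 g2 h)?; simp add: continuous_on_reindex)+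
  let ?F = "{z. (fst \<circ> g \<circ> ?e) z = (h \<circ> ?o) z} \<inter> ?o -` E"
  have cl: "closed {z. (fst \<circ> g \<circ> ?e) z = (h \<circ> ?o) z}"
    using closedin_continuous_maps_eq[OF X ge(1,3)] by simp
  have "?o -` E \<in> sets borel"
    using measurable_sets[OF borel_measurable_continuous_onI[OF continuous_on_reindex] E(1)] by simp
  then have F: "?F \<in> sets borel" by (rule sets.Int[OF borel_closed[OF cl]])
  have "?N = (snd \<circ> g \<circ> ?e) ` ?F"
  proof (intro equalityI subsetI)
    fix y assume "y \<in> ?N"
    then obtain w z where w: "w \<in> E" "(h w, y) = g z" unfolding E(2) by blast
    show "y \<in> (snd \<circ> g \<circ> ?e) ` ?F"
    proof
      let ?u = "\<lambda>l. if even l then z (l div 2) else w (l div 2)"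
      have "?e ?u = z" "?o ?u = w" by auto
      then show "y = (snd \<circ> g \<circ> ?e) ?u" "?u \<in> ?F"
        using w by (simp_all add: prod_eq_iff)
    qed
  next
    fix y assume "y \<in> (snd \<circ> g \<circ> ?e) ` ?F"
    then obtain z where z: "y = snd (g (?e z))" "fst (g (?e z)) = h (?o z)" "?o z \<in> E" by auto
    then have "(h (?o z), y) \<in> range g" by (intro range_eqI[of _ _ "?e z"]) (simp add: prod_eq_iff)
    then show "y \<in> ?N" using z(3) E(2) by blast
  qed
  then have "suslin X ?N" using ge(2) F unfolding suslin_def by blast
  moreover have "A \<inter> ?N = {}" using indep by (auto simp: restrict_graph_def)
  ultimately have "borel_separated X A ?N" by (rule Lusin_separation[OF X A])
  then obtain B0 where B0: "B0 \<in> sets (borel_of X)" "A \<subseteq> B0" "B0 \<inter> ?N = {}"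
    unfolding borel_separated_def by blast
  let ?M = "(fst \<circ> g) ` ((snd \<circ> g) -` B0)"
  have "suslin X ?M" using g1 vimage_borel_of[OF g2 B0(1)] unfolding suslin_def by blast
  moreover have "A \<inter> ?M = {}"
  proof (rule ccontr)
    assume "A \<inter> ?M \<noteq> {}"
    then obtain z where z: "fst (g z) \<in> A" "snd (g z) \<in> B0" by auto
    moreover have "(fst (g z), snd (g z)) \<in> range g" by simp
    ultimately have "snd (g z) \<in> ?N" by blast
    with z(2) B0(3) show False by blast
  qed
  ultimately have "borel_separated X A ?M" by (rule Lusin_separation[OF X A])
  then obtain B1 where B1: "B1 \<in> sets (borel_of X)" "A \<subseteq> B1" "B1 \<inter> ?M = {}"
    unfolding borel_separated_def by blast
  show thesis
  proof
    show "B0 \<inter> B1 \<in> sets (borel_of X)" using B0 B1 by blast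
    show "A \<subseteq> B0 \<inter> B1" using B0 B1 by blast
    show "restrict_graph (range g) (B0 \<inter> B1) = {}"
    proof (rule ccontr)
      assume "restrict_graph (range g) (B0 \<inter> B1) \<noteq> {}"
      then obtain x y z where "x \<in> B1" "y \<in> B0" "g z = (x, y)"
        unfolding restrict_graph_def by fastforce
      then have "x \<in> ?M" by (intro image_eqI[of _ _ z]) auto
      with B1(3) \<open>x \<in> B1\<close> show False by blast
    qed
  qed
qed

text \<open>Countably many sequences are coded by a single one, which \<open>d\<close> decodes
  continuously and onto; this makes configurations admissible as parameters.\<close>

lemma suslin_image:
  fixes h :: "('c::countable \<Rightarrow> nat \<Rightarrow> nat) \<Rightarrow> 'a"
  assumes h: "continuous_map euclidean X h" and E: "E \<in> sets borel"
  shows "suslin X (h ` E)"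
proof -
  define d :: "(nat \<Rightarrow> nat) \<Rightarrow> 'c \<Rightarrow> nat \<Rightarrow> nat" where "d z c l = z (to_nat (c, l))" for z c l
  have cont: "continuous_on UNIV d"
    unfolding d_def[abs_def]
    by (intro continuous_on_coordinatewise_then_product continuous_on_product_coordinates)
  have "surj d"
  proof (rule surjI)
    show "d (\<lambda>i. case from_nat i of (c, l) \<Rightarrow> w c l) = w" for w
      by (simp add: d_def fun_eq_iff)
  qed
  then have "h ` E = (h \<circ> d) ` (d -` E)"
    by (metis image_comp surj_image_vimage_eq)
  moreover have "continuous_map euclidean X (h \<circ> d)"
    by (rule continuous_map_compose[OF _ h]) (simp add: cont)
  moreover have "d -` E \<in> sets borel"
    using measurable_sets[OF borel_measurable_continuous_onI[OF cont] E] by simp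
  ultimately show ?thesis unfolding suslin_def by blast
qed

section \<open>Baire category in Cantor space\<close>

text \<open>Meager sets are the subsets of \<open>\<Union>\<M>\<close> for such \<open>\<M>\<close>;
  an explicit cover makes countable unions and preimages easy.\<close>

definition meager_cover :: "'b::topological_space set set \<Rightarrow> bool" where
  "meager_cover \<M> \<longleftrightarrow> countable \<M> \<and> (\<forall>M\<in>\<M>. closed M \<and> interior M = {})"

lemma Baire_Cantor:
  fixes \<M> :: "(nat \<Rightarrow> bool) set set"
  assumes "meager_cover \<M>"
  shows "interior (\<Union>\<M>) = {}"
proof -
  have "(euclidean :: bool topology) = discrete_topology UNIV"
    by (simp add: topology_eq open_discrete)
  then have top: "(euclidean :: (nat \<Rightarrow> bool) topology) = product_topology (\<lambda>_. discrete_topology UNIV) UNIV"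
    by (simp add: euclidean_product_topology[symmetric])
  have "compact_space (euclidean :: (nat \<Rightarrow> bool) topology)"
    unfolding top by (simp add: compact_space_product_topology compact_space_discrete_topology)
  moreover have "Hausdorff_space (euclidean :: (nat \<Rightarrow> bool) topology)"
    unfolding top by (simp add: Hausdorff_space_product_topology)
  ultimately have "locally_compact_space (euclidean :: (nat \<Rightarrow> bool) topology)
      \<and> regular_space (euclidean :: (nat \<Rightarrow> bool) topology)"
    by (simp add: compact_imp_locally_compact_space compact_Hausdorff_imp_regular_space)
  then have "(euclidean :: (nat \<Rightarrow> bool) topology) interior_of \<Union>\<M> = {}"
    using assms by (intro Baire_category_alt) (auto simp: meager_cover_def)
  then show ?thesis by simp
qed

definition Baire_property :: "'b::topological_space set \<Rightarrow> bool" where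
  "Baire_property E \<longleftrightarrow> (\<exists>U \<M>. open U \<and> meager_cover \<M> \<and> E - U \<subseteq> \<Union>\<M> \<and> U - E \<subseteq> \<Union>\<M>)"

lemma Baire_property_borel:
  assumes "E \<in> sets borel"
  shows "Baire_property E"
proof -
  have "E \<in> sigma_sets UNIV {S. open S}"
    using assms by (simp add: borel_def)
  then show ?thesis
  proof induction
    case (Basic U)
    then show ?case unfolding Baire_property_def meager_cover_def
      by (intro exI[of _ U] exI[of _ "{}"]) auto
  next
    case Empty
    then show ?case unfolding Baire_property_def meager_cover_def
      by (intro exI[of _ "{}"]) auto
  next
    case (Compl E)
    then obtain U \<M> where U: "open U" "meager_cover \<M>" "E - U \<subseteq> \<Union>\<M>" "U - E \<subseteq> \<Union>\<M>"
      unfolding Baire_property_def by auto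
    \<comment> \<open>The boundary of an open set is nowhere dense, so replacing \<open>- U\<close>
      by the open set \<open>- closure U\<close> costs only one more member of the cover.\<close>
    have "interior (closure U - U) = {}"
    proof -
      have "interior (closure U - U) \<inter> U = {}" using interior_subset by blast
      then have "interior (closure U - U) \<inter> closure U = {}"
        by (simp add: open_Int_closure_eq_empty)
      then show ?thesis using interior_subset by blast
    qed
    moreover have "closed (closure U - U)" using U(1) by (intro closed_Diff) auto
    ultimately have "meager_cover (insert (closure U - U) \<M>)"
      using U(2) by (simp add: meager_cover_def)
    moreover have "(UNIV - E) - (- closure U) \<subseteq> \<Union>(insert (closure U - U) \<M>)"
      "(- closure U) - (UNIV - E) \<subseteq> \<Union>(insert (closure U - U) \<M>)"
      using U(3,4) closure_subset[of U] by auto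
    ultimately show ?case unfolding Baire_property_def
      by (intro exI[of _ "- closure U"] exI[of _ "insert (closure U - U) \<M>"]) auto
  next
    case (Union E)
    then obtain U \<M> where U: "\<And>i. open (U i)" "\<And>i. meager_cover (\<M> i)"
      "\<And>i. E i - U i \<subseteq> \<Union>(\<M> i)" "\<And>i. U i - E i \<subseteq> \<Union>(\<M> i)"
      unfolding Baire_property_def by metis
    have "meager_cover (\<Union>i. \<M> i)" using U(2) by (auto simp: meager_cover_def)
    moreover have "(\<Union>i. E i) - (\<Union>i. U i) \<subseteq> (\<Union>i. \<Union>(\<M> i))"
      "(\<Union>i. U i) - (\<Union>i. E i) \<subseteq> (\<Union>i. \<Union>(\<M> i))"
      using U(3,4) by fast+
    moreover have "\<Union>(\<Union>i. \<M> i) = (\<Union>i. \<Union>(\<M> i))" by blast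
    ultimately show ?case unfolding Baire_property_def
      using U(1) by (intro exI[of _ "\<Union>i. U i"] exI[of _ "\<Union>i. \<M> i"]) (simp add: open_UN)
  qed
qed

text \<open>Were all open approximations empty, the whole space would be meager; so some
  \<open>E n\<close> is comeager in a nonempty open set and hence in a cylinder.\<close>

lemma nonmeager_piece:
  fixes E :: "nat \<Rightarrow> (nat \<Rightarrow> bool) set"
  assumes E: "\<And>n. E n \<in> sets borel" and cover: "(\<Union>n. E n) = UNIV"
  obtains n t \<M> where "meager_cover \<M>" "{x. \<forall>l<length t. x l = t ! l} - E n \<subseteq> \<Union>\<M>"
proof -
  obtain U \<M> where U: "\<And>n. open (U n)" "\<And>n. meager_cover (\<M> n)"
      "\<And>n. E n - U n \<subseteq> \<Union>(\<M> n)" "\<And>n. U n - E n \<subseteq> \<Union>(\<M> n)"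
    using Baire_property_borel[OF E] unfolding Baire_property_def by metis
  have "\<exists>n. U n \<noteq> {}"
  proof (rule ccontr)
    assume "\<nexists>n. U n \<noteq> {}"
    then have "E n \<subseteq> \<Union>(\<M> n)" for n using U(3)[of n] by simp
    then have "(\<Union>n. E n) \<subseteq> (\<Union>n. \<Union>(\<M> n))" by (intro UN_mono) auto
    moreover have "\<Union>(\<Union>n. \<M> n) = (\<Union>n. \<Union>(\<M> n))" by blast
    ultimately have "\<Union>(\<Union>n. \<M> n) = UNIV" unfolding cover by (intro equalityI subset_UNIV) (simp only:)
    moreover have "meager_cover (\<Union>n. \<M> n)" using U(2) by (auto simp: meager_cover_def)
    ultimately show False using Baire_Cantor[of "\<Union>n. \<M> n"] by simp
  qed
  then obtain n x where "x \<in> U n" by auto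
  then obtain m where m: "{y. \<forall>l<m. y l = x l} \<subseteq> U n"
    using open_contains_cylinder[OF U(1)] by blast
  have "{y. \<forall>l<length (map x [0..<m]). y l = map x [0..<m] ! l} \<subseteq> U n" using m by auto
  then show thesis using U(2,4)[of n] by (intro that[of "\<M> n" "map x [0..<m]" n]) auto
qed

text \<open>Flipping a bit is a continuous involution, so preimages of closed nowhere dense sets are
  again closed and nowhere dense.\<close>

lemma meager_cover_flip:
  fixes \<M> :: "(nat \<Rightarrow> bool) set set"
  assumes \<M>: "meager_cover \<M>"
  shows "meager_cover ((\<lambda>M. (\<lambda>x. x(n := \<not> x n)) -` M) ` \<M>)"
proof -
  let ?f = "\<lambda>x :: nat \<Rightarrow> bool. x(n := \<not> x n)"
  have ff: "?f (?f x) = x" for x by auto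
  have cont: "continuous_on UNIV ?f"
  proof (rule continuous_on_coordinatewise_then_product)
    fix i
    show "continuous_on UNIV (\<lambda>x. ?f x i)"
    proof (cases "i = n")
      case True
      have "continuous_on UNIV (Not \<circ> (\<lambda>x :: nat \<Rightarrow> bool. x n))"
        by (intro continuous_on_compose continuous_on_product_coordinates)
          (simp add: continuous_on_discrete)
      then show ?thesis using True by (simp add: o_def)
    qed simp
  qed
  have "interior (?f -` M) = {}" if "interior M = {}" for M
  proof -
    have "open (?f -` interior (?f -` M))" by (intro open_vimage cont) simp
    moreover have "?f -` interior (?f -` M) \<subseteq> M"
    proof
      fix x assume "x \<in> ?f -` interior (?f -` M)"
      then have "?f x \<in> ?f -` M" using interior_subset by blast
      then show "x \<in> M" by simp
    qed
    ultimately have "?f -` interior (?f -` M) \<subseteq> interior M" by (simp add: interior_maximal)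
    then have empty: "?f -` interior (?f -` M) = {}" using that by simp
    show ?thesis
    proof (rule equals0I)
      fix x assume "x \<in> interior (?f -` M)"
      then have "?f x \<in> ?f -` interior (?f -` M)" by (simp add: ff)
      then show False unfolding empty by simp
    qed
  qed
  then show ?thesis
    using \<M> closed_vimage[OF _ cont] by (auto simp: meager_cover_def)
qed

section \<open>Incompatibility of the two alternatives\<close>

lemma alternatives_exclusive:
  fixes k :: "nat \<Rightarrow> nat" and s :: "nat \<Rightarrow> bool list" and X :: "'a topology"
    and G :: "nat \<Rightarrow> nat \<Rightarrow> ('a \<times> 'a) set" and B :: "nat \<Rightarrow> 'a set" and f :: "nat \<Rightarrow> nat"
    and \<phi> :: "(nat \<Rightarrow> bool) \<Rightarrow> 'a"
  assumes s_length: "\<And>n. length (s n) = n"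
    and s_dense: "\<And>j t. \<exists>n. j = k n \<and> Sublist.prefix t (s n)"
    and B: "\<And>n. B n \<in> sets (borel_of X)" and cover: "topspace X = (\<Union>n. B n)"
    and chrom: "\<And>n. \<exists>i. \<forall>j. borel_chromatic_le_aleph0 (subtopology X (B n)) (restrict_graph (G i j) (B n))"
    and \<phi>: "continuous_map euclidean X \<phi>"
    and hom: "seq_homomorphism \<phi> (GG0 k s) (\<lambda>l. G l (f l))"
  shows False
proof -
  obtain i where "\<And>n j. borel_chromatic_le_aleph0 (subtopology X (B n)) (restrict_graph (G (i n) j) (B n))"
    using chrom by metis
  then have "\<forall>n. \<exists>c :: 'a \<Rightarrow> nat. c \<in> borel_measurable (borel_of (subtopology X (B n))) \<and>
      (\<forall>(x, y)\<in>restrict_graph (G (i n) (f (i n))) (B n). c x \<noteq> c y)"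
    unfolding borel_chromatic_le_aleph0_def by blast
  then obtain c :: "nat \<Rightarrow> 'a \<Rightarrow> nat" where
    c: "\<And>n. c n \<in> borel_measurable (borel_of (subtopology X (B n)))" and
    col: "\<And>n. \<forall>(x, y)\<in>restrict_graph (G (i n) (f (i n))) (B n). c n x \<noteq> c n y"
    by metis
  \<comment> \<open>The pieces are indexed by pairs consisting of the number of a Borel set and a
    colour.\<close>
  define E where "E p = \<phi> -` (c (fst p) -` {snd p} \<inter> B (fst p))" for p
  have "E p \<in> sets borel" for p
  proof -
    have "space (borel_of (subtopology X (B (fst p)))) = B (fst p)"
      using sets.sets_into_space[OF B[of "fst p"]] by (auto simp: space_borel_of)
    then have "c (fst p) -` {snd p} \<inter> B (fst p) \<in> sets (borel_of (subtopology X (B (fst p))))"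
      using measurable_sets[OF c[of "fst p"], of "{snd p}"] by simp
    then show ?thesis unfolding E_def
      by (intro vimage_borel_of[OF \<phi>] borel_of_subtopology_subset[OF B])
  qed
  moreover have "(\<Union>l. E (prod_decode l)) = UNIV"
  proof (intro equalityI subset_UNIV subsetI)
    fix x
    have "\<phi> x \<in> topspace X" using \<phi> by (auto simp: continuous_map_def)
    then obtain n where "\<phi> x \<in> B n" using cover by auto
    then have "x \<in> E (prod_decode (prod_encode (n, c n (\<phi> x))))" by (simp add: E_def)
    then show "x \<in> (\<Union>l. E (prod_decode l))" by blast
  qed
  ultimately obtain l t \<M> where \<M>: "meager_cover \<M>"
    "{x. \<forall>l<length t. x l = t ! l} - E (prod_decode l) \<subseteq> \<Union>\<M>"
    by (rule nonmeager_piece)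
  obtain a m where am: "prod_decode l = (a, m)" by (cases "prod_decode l")
  \<comment> \<open>The index is the one at which \<open>B a\<close> has its colourings, so edges at
    \<open>s n\<close> are sent into the graph coloured by \<open>c a\<close>.\<close>
  obtain n where n: "k n = i a" "Sublist.prefix t (s n)" using s_dense[of "i a" t] by auto
  let ?f = "\<lambda>x :: nat \<Rightarrow> bool. x(n := \<not> x n)"
  \<comment> \<open>Avoiding \<open>\<Union>?N\<close> keeps both a point and its flip at
    \<open>n\<close> off the meager set.\<close>
  let ?N = "\<M> \<union> (\<lambda>M. ?f -` M) ` \<M>"
  let ?x = "s n \<frown> (\<lambda>_. False)"
  \<comment> \<open>Length \<open>Suc n\<close> also fixes bit \<open>n\<close> to
    \<open>False\<close>, so that a point of \<open>?O\<close> and its flip form, in this order, an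
    edge of \<open>GG_node (s n)\<close>.\<close>
  let ?O = "{x. \<forall>l<Suc n. x l = ?x l}"
  have "meager_cover ?N"
    using \<M>(1) meager_cover_flip[OF \<M>(1), of n] by (auto simp: meager_cover_def)
  then have empty: "interior (\<Union>?N) = {}" by (rule Baire_Cantor)
  have "\<not> ?O \<subseteq> \<Union>?N"
  proof
    assume "?O \<subseteq> \<Union>?N"
    then have "?O \<subseteq> interior (\<Union>?N)" using open_cylinder by (rule interior_maximal)
    moreover have "?x \<in> ?O" by (intro CollectI allI impI refl)
    ultimately show False unfolding empty by (rule subsetD[THEN emptyE])
  qed
  then obtain x where x: "x \<in> ?O" "x \<notin> \<Union>?N" by (auto simp only: subset_iff)
  have "\<Union>\<M> \<subseteq> \<Union>?N" by (intro Union_mono Un_upper1)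
  with x(2) have nM1: "x \<notin> \<Union>\<M>" by (rule contra_subsetD[rotated])
  have nM2: "?f x \<notin> \<Union>\<M>"
  proof
    assume "?f x \<in> \<Union>\<M>"
    then obtain M where "M \<in> \<M>" "x \<in> ?f -` M" by auto
    then have "x \<in> \<Union>?N" by (intro UnionI[of "?f -` M"]) simp_all
    with x(2) show False ..
  qed
  have xs: "x l = s n ! l" if "l < n" for l using x(1) that s_length by simp
  have xn: "\<not> x n" using x(1) s_length by simp
  have t: "l < length t \<Longrightarrow> t ! l = s n ! l \<and> l < n" for l
    using n(2) s_length[of n] by (auto simp: Sublist.prefix_def nth_append)
  have inE_I: "y \<in> E (a, m)" if "\<And>l. l < length t \<Longrightarrow> y l = t ! l" "y \<notin> \<Union>\<M>" for y
  proof (rule ccontr)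
    assume "y \<notin> E (a, m)"
    then have "y \<in> {x. \<forall>l<length t. x l = t ! l} - E (prod_decode l)" using that(1) by (simp add: am)
    with \<M>(2) that(2) show False by (rule contra_subsetD[THEN notE])
  qed
  have inE: "x \<in> E (a, m)" by (rule inE_I[OF _ nM1]) (simp add: t xs)
  have inE': "?f x \<in> E (a, m)"
  proof (rule inE_I[OF _ nM2])
    fix l assume "l < length t"
    from t[OF this] xs show "?f x l = t ! l" by simp
  qed
  define d where "d l = x (Suc n + l)" for l
  have "x = (s n @ [False]) \<frown> d" "?f x = (s n @ [True]) \<frown> d"
    by (auto simp: fun_eq_iff conc_def nth_append s_length d_def xs xn less_Suc_eq)
  then have "(x, ?f x) \<in> GG_node (s n)"
    unfolding GG_node_def by (intro CollectI exI[of _ d]) simp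
  then have "(x, ?f x) \<in> GG0 k s (i a)"
    unfolding GG0_def using n(1) by (intro UN_I[of n]) simp_all
  then have "(\<phi> x, \<phi> (?f x)) \<in> G (i a) (f (i a))"
    using hom unfolding seq_homomorphism_def by blast
  moreover have "\<phi> x \<in> B a" "\<phi> (?f x) \<in> B a" "c a (\<phi> x) = c a (\<phi> (?f x))"
    using inE inE' by (simp_all add: E_def)
  ultimately have "(\<phi> x, \<phi> (?f x)) \<in> restrict_graph (G (i a) (f (i a))) (B a)"
    by (simp add: restrict_graph_def)
  from bspec[OF col this] \<open>c a (\<phi> x) = c a (\<phi> (?f x))\<close> show False by simp
qed

section \<open>The ideal of null sets\<close>

text \<open>For Borel \<open>B\<close> this amounts to countable Borel chromatic number of
  \<open>R\<close> on \<open>B\<close>; in this form it passes at once to subsets and countable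
  unions.\<close>

definition sigma_independent :: "'a topology \<Rightarrow> ('a \<times> 'a) set \<Rightarrow> 'a set \<Rightarrow> bool" where
  "sigma_independent X R B \<longleftrightarrow> (\<exists>\<C>. countable \<C> \<and> \<C> \<subseteq> sets (borel_of X) \<and>
     (\<forall>C\<in>\<C>. restrict_graph R C = {}) \<and> B \<subseteq> \<Union>\<C>)"

lemma sigma_independent_mono:
  "sigma_independent X R B \<Longrightarrow> R' \<subseteq> R \<Longrightarrow> B' \<subseteq> B \<Longrightarrow> sigma_independent X R' B'"
  unfolding sigma_independent_def restrict_graph_def
  by (elim ex_forward conj_forward) auto

lemma sigma_independent_Union:
  assumes "countable \<B>" "\<And>B. B \<in> \<B> \<Longrightarrow> sigma_independent X R B"
  shows "sigma_independent X R (\<Union>\<B>)"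
proof -
  obtain \<C> where \<C>: "\<And>B. B \<in> \<B> \<Longrightarrow> countable (\<C> B)" "\<And>B. B \<in> \<B> \<Longrightarrow> \<C> B \<subseteq> sets (borel_of X)"
    "\<And>B C. B \<in> \<B> \<Longrightarrow> C \<in> \<C> B \<Longrightarrow> restrict_graph R C = {}" "\<And>B. B \<in> \<B> \<Longrightarrow> B \<subseteq> \<Union>(\<C> B)"
    using assms(2) unfolding sigma_independent_def by metis
  show ?thesis unfolding sigma_independent_def
  proof (intro exI conjI)
    show "countable (\<Union>B\<in>\<B>. \<C> B)" using \<C>(1) assms(1) by blast
    show "(\<Union>B\<in>\<B>. \<C> B) \<subseteq> sets (borel_of X)" using \<C>(2) by blast
    show "\<forall>C\<in>\<Union>B\<in>\<B>. \<C> B. restrict_graph R C = {}" using \<C>(3) by blast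
    show "\<Union>\<B> \<subseteq> \<Union>(\<Union>B\<in>\<B>. \<C> B)" using \<C>(4) by fastforce
  qed
qed

text \<open>A point receives as colour the least index of a member of the cover that contains
  it.\<close>

lemma sigma_independent_chromatic:
  assumes B: "B \<in> sets (borel_of X)" and ind: "sigma_independent X R B"
  shows "borel_chromatic_le_aleph0 (subtopology X B) (restrict_graph R B)"
proof -
  obtain \<C> where \<C>: "countable \<C>" "\<C> \<subseteq> sets (borel_of X)"
    "\<And>C. C \<in> \<C> \<Longrightarrow> restrict_graph R C = {}" "B \<subseteq> \<Union>\<C>"
    using ind unfolding sigma_independent_def by blast
  \<comment> \<open>Adding \<open>{}\<close> makes the family nonempty, as its enumeration
    requires.\<close>
  define C where "C = from_nat_into (insert {} \<C>)"
  have range_C: "range C = insert {} \<C>"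
    unfolding C_def using \<C>(1) by (intro range_from_nat_into) auto
  have C_cases: "C n = {} \<or> C n \<in> \<C>" for n
    using rangeI[of C n] unfolding range_C by simp
  have C_sets: "C n \<in> sets (borel_of X)" for n using C_cases[of n] \<C>(2) by auto
  have C_ind: "restrict_graph R (C n) = {}" for n
    using C_cases[of n] \<C>(3) by (auto simp: restrict_graph_def)
  have cover: "\<exists>n. x \<in> C n" if x: "x \<in> B" for x
  proof -
    from x \<C>(4) obtain D where "D \<in> \<C>" "x \<in> D" by blast
    then have "D \<in> range C" by (simp add: range_C)
    with \<open>x \<in> D\<close> show ?thesis by (elim rangeE) auto
  qed
  define c where "c x = (LEAST n. x \<in> C n)" for x
  have c: "x \<in> C (c x)" if "x \<in> B" for x
    unfolding c_def using cover[OF that] by (rule LeastI_ex)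
  have space: "space (borel_of (subtopology X B)) = B"
    using sets.sets_into_space[OF B] by (auto simp: space_borel_of)
  have single: "c -` {n} \<inter> B = (C n - (\<Union>m<n. C m)) \<inter> B" for n
  proof -
    have "c x = n \<longleftrightarrow> x \<in> C n \<and> (\<forall>m<n. x \<notin> C m)" if "x \<in> B" for x
    proof
      assume "c x = n"
      then show "x \<in> C n \<and> (\<forall>m<n. x \<notin> C m)"
        using c[OF that] not_less_Least unfolding c_def by blast
    next
      assume "x \<in> C n \<and> (\<forall>m<n. x \<notin> C m)"
      then show "c x = n" unfolding c_def by (intro Least_equality) (auto simp: not_less[symmetric])
    qed
    then show ?thesis by auto
  qed
  have "c \<in> borel_measurable (borel_of (subtopology X B))"
  proof (rule measurableI)
    fix A :: "nat set"
    have "C n - (\<Union>m<n. C m) \<in> sets (borel_of X)" for n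
      by (intro sets.Diff sets.finite_UN C_sets) auto
    then have "c -` {n} \<inter> B \<in> sets (borel_of (subtopology X B))" for n
      unfolding single by (rule borel_of_Int_subtopology)
    then have "(\<Union>n\<in>A. c -` {n} \<inter> B) \<in> sets (borel_of (subtopology X B))"
      by (intro sets.countable_UN) auto
    moreover have "c -` A \<inter> B = (\<Union>n\<in>A. c -` {n} \<inter> B)" by auto
    ultimately show "c -` A \<inter> space (borel_of (subtopology X B)) \<in> sets (borel_of (subtopology X B))"
      unfolding space by simp
  qed simp
  moreover have "c x \<noteq> c y" if "(x, y) \<in> restrict_graph R B" for x y
  proof
    assume "c x = c y"
    moreover have "x \<in> B" "y \<in> B" "(x, y) \<in> R" using that by (auto simp: restrict_graph_def)
    ultimately have "(x, y) \<in> restrict_graph R (C (c x))"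
      using c[of x] c[of y] by (simp add: restrict_graph_def)
    then show False by (simp add: C_ind)
  qed
  ultimately show ?thesis unfolding borel_chromatic_le_aleph0_def by blast
qed

lemma borel_chromatic_mono:
  assumes "borel_chromatic_le_aleph0 T R" "R' \<subseteq> R"
  shows "borel_chromatic_le_aleph0 T R'"
  using assms(1) unfolding borel_chromatic_le_aleph0_def
  by (elim ex_forward conj_forward) (use assms(2) in auto)

text \<open>Every \<open>G i j\<close> is a full image of \<open>\<nat>\<^sup>\<nat>\<close> and
  hence nonempty; the theorem is reduced to this case at the end.\<close>

locale parametrized_graphs =
  fixes X :: "'a topology" and g :: "nat \<Rightarrow> nat \<Rightarrow> (nat \<Rightarrow> nat) \<Rightarrow> 'a \<times> 'a"
    and G :: "nat \<Rightarrow> nat \<Rightarrow> ('a \<times> 'a) set"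
  assumes Hausdorff: "Hausdorff_space X"
    and continuous_g: "\<And>i j. continuous_map euclidean (prod_topology X X) (g i j)"
    and range_g: "\<And>i j. range (g i j) = G i j"
    and increasing: "\<And>i j. G i j \<subseteq> G i (Suc j)"
begin

lemma G_mono: "j \<le> j' \<Longrightarrow> G i j \<subseteq> G i j'"
  using increasing by (rule lift_Suc_mono_le)

text \<open>The first two coordinates select a graph and the rest an edge of it, so one map
  parametrizes the first endpoints of all edges of all graphs.\<close>

definition vertex :: "(nat \<Rightarrow> nat) \<Rightarrow> 'a" where
  "vertex y = fst (g (y 0) (y 1) (\<lambda>l. y (l + 2)))"

lemma continuous_fst_g: "continuous_map euclidean X (fst \<circ> g i j)"
  and continuous_snd_g: "continuous_map euclidean X (snd \<circ> g i j)"
  using continuous_g by (simp_all add: continuous_map_pairwise)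

lemma continuous_vertex: "continuous_map euclidean X vertex"
proof -
  have "open (vertex -` U)" if "openin X U" for U
  proof -
    have "open ((fst \<circ> g i j) -` U)" for i j
      using continuous_fst_g[of i j] that by (auto simp: continuous_map_def vimage_def)
    then have "open ((\<lambda>y l. y (l + 2)) -` (fst \<circ> g i j) -` U)" for i j
      by (intro open_vimage continuous_on_reindex)
    moreover have "open ((\<lambda>y :: nat \<Rightarrow> nat. y l) -` {i})" for l i
      by (intro open_vimage open_discrete continuous_on_product_coordinates)
    ultimately have "open (\<Union>i j. (\<lambda>y. y 0) -` {i} \<inter> (\<lambda>y. y 1) -` {j} \<inter>
        (\<lambda>y l. y (l + 2)) -` (fst \<circ> g i j) -` U)"
      by (intro open_UN ballI open_Int)
    moreover have "vertex -` U = (\<Union>i j. (\<lambda>y. y 0) -` {i} \<inter> (\<lambda>y. y 1) -` {j} \<inter>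
        (\<lambda>y l. y (l + 2)) -` (fst \<circ> g i j) -` U)"
      by (auto simp: vertex_def)
    ultimately show ?thesis by simp
  qed
  moreover have "vertex y \<in> topspace X" for y
    using continuous_fst_g[of "y 0" "y 1"] by (auto simp: vertex_def continuous_map_def)
  ultimately show ?thesis by (auto simp: continuous_map_def vimage_def)
qed

lemma fst_in_range_vertex: "(x, y) \<in> G i j \<Longrightarrow> x \<in> range vertex"
proof -
  assume "(x, y) \<in> G i j"
  then obtain z where z: "g i j z = (x, y)" unfolding range_g[symmetric] by auto
  have "vertex (\<lambda>l. if l = 0 then i else if l = 1 then j else z (l - 2)) = x"
    by (simp add: vertex_def z)
  then show ?thesis by (metis rangeI)
qed

section \<open>The \<sigma>-ideal of null sets relative to \<open>J\<close>\<close>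

definition negligible :: "(nat \<Rightarrow> nat set) \<Rightarrow> 'a set \<Rightarrow> bool" where
  "negligible J B \<longleftrightarrow> B \<in> sets (borel_of X) \<and> (\<exists>i. \<forall>j\<in>J i. sigma_independent X (G i j) B)"

definition null :: "(nat \<Rightarrow> nat set) \<Rightarrow> 'a set \<Rightarrow> bool" where
  "null J N \<longleftrightarrow> (\<exists>\<B>. countable \<B> \<and> (\<forall>B\<in>\<B>. negligible J B) \<and> N \<subseteq> \<Union>\<B>)"

lemma null_empty: "null J {}"
  unfolding null_def by (intro exI[of _ "{}"]) auto

lemma null_mono:
  assumes "null J N" "M \<subseteq> N"
  shows "null J M"
  using assms(1) unfolding null_def
  by (elim ex_forward conj_forward) (use assms(2) in auto)

lemma null_negligible: "negligible J B \<Longrightarrow> N \<subseteq> B \<Longrightarrow> null J N"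
  unfolding null_def by (intro exI[of _ "{B}"]) auto

lemma null_Borel_hull:
  assumes "null J N"
  obtains M where "null J M" "M \<in> sets (borel_of X)" "N \<subseteq> M"
proof -
  obtain \<B> where \<B>: "countable \<B>" "\<forall>B\<in>\<B>. negligible J B" "N \<subseteq> \<Union>\<B>"
    using assms unfolding null_def by auto
  show thesis
  proof
    show "null J (\<Union>\<B>)" using \<B> unfolding null_def by blast
    show "\<Union>\<B> \<in> sets (borel_of X)"
      using \<B>(1,2) by (intro sets.countable_Union) (auto simp: negligible_def)
  qed (rule \<B>(3))
qed

lemma null_UN:
  assumes "countable I" "\<And>a. a \<in> I \<Longrightarrow> null J (N a)"
  shows "null J (\<Union>a\<in>I. N a)"
proof -
  have "\<forall>a\<in>I. \<exists>\<B>. countable \<B> \<and> (\<forall>B\<in>\<B>. negligible J B) \<and> N a \<subseteq> \<Union>\<B>"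
    using assms(2) unfolding null_def by simp
  from bchoice[OF this] obtain \<B> where
    \<B>: "\<forall>a\<in>I. countable (\<B> a) \<and> (\<forall>B\<in>\<B> a. negligible J B) \<and> N a \<subseteq> \<Union>(\<B> a)" ..
  show ?thesis unfolding null_def
  proof (intro exI conjI)
    show "countable (\<Union>a\<in>I. \<B> a)" using \<B> assms(1) by (intro countable_UN) auto
    show "\<forall>B\<in>\<Union>a\<in>I. \<B> a. negligible J B" using \<B> by auto
    show "(\<Union>a\<in>I. N a) \<subseteq> \<Union>(\<Union>a\<in>I. \<B> a)" using \<B> by fastforce
  qed
qed

lemma null_Un: "null J M \<Longrightarrow> null J N \<Longrightarrow> null J (M \<union> N)"
  using null_UN[of UNIV J "\<lambda>b. if b then M else N"] by (simp add: UNIV_bool Un_commute)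

text \<open>Independence for the larger graph \<open>G i j'\<close> implies independence for
  \<open>G i j\<close>.\<close>

lemma null_upd_mono:
  assumes "j \<le> j'" "null (J(i := {j'})) N"
  shows "null (J(i := {j})) N"
proof -
  have "negligible (J(i := {j})) B" if B: "negligible (J(i := {j'})) B" for B
  proof -
    from B obtain i' where i': "B \<in> sets (borel_of X)"
      "\<And>l. l \<in> (J(i := {j'})) i' \<Longrightarrow> sigma_independent X (G i' l) B"
      unfolding negligible_def by auto
    have "sigma_independent X (G i' l) B" if "l \<in> (J(i := {j})) i'" for l
    proof (cases "i' = i")
      case True
      then show ?thesis
        using that i'(2)[of j'] sigma_independent_mono[OF _ G_mono[OF \<open>j \<le> j'\<close>] subset_refl] by simp
    next
      case False
      then show ?thesis using that i'(2)[of l] by simp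
    qed
    then show ?thesis using i'(1) unfolding negligible_def by (intro conjI exI[of _ i'] ballI)
  qed
  then show ?thesis
    using assms(2) unfolding null_def by (elim ex_forward conj_forward) auto
qed

text \<open>In the cover of \<open>N j\<close>, let \<open>\<D> j\<close> collect the sets that are
  \<sigma>-independent for \<open>G i j\<close>; the other sets are negligible through an index
  different from \<open>i\<close>, hence also for \<open>J\<close>. A point of all
  \<open>N j\<close> lies in one of those others or in every \<open>\<Union>(\<D> j)\<close>, and
  the intersection of the latter is \<sigma>-independent for all \<open>G i j\<close> at
  once.\<close>

lemma null_INT:
  assumes J: "J i = UNIV" and N: "\<And>j. null (J(i := {j})) (N j)"
  shows "null J (\<Inter>j. N j)"
proof -
  have "\<forall>j. \<exists>\<B>. countable \<B> \<and> (\<forall>B\<in>\<B>. negligible (J(i := {j})) B) \<and> N j \<subseteq> \<Union>\<B>"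
    using N unfolding null_def by simp
  from choice[OF this] obtain \<B> where
    "\<forall>j. countable (\<B> j) \<and> (\<forall>B\<in>\<B> j. negligible (J(i := {j})) B) \<and> N j \<subseteq> \<Union>(\<B> j)" ..
  then have \<B>: "\<And>j. countable (\<B> j)" "\<And>j B. B \<in> \<B> j \<Longrightarrow> negligible (J(i := {j})) B" "\<And>j. N j \<subseteq> \<Union>(\<B> j)"
    by auto
  define \<D> where "\<D> j = {B \<in> \<B> j. sigma_independent X (G i j) B}" for j
  have rest: "negligible J B" if "B \<in> \<B> j" "B \<notin> \<D> j" for j B
  proof -
    have nsi: "\<not> sigma_independent X (G i j) B" using that by (simp add: \<D>_def)
    from \<B>(2)[OF that(1)] obtain i' where i': "B \<in> sets (borel_of X)"
      "\<And>l. l \<in> (J(i := {j})) i' \<Longrightarrow> sigma_independent X (G i' l) B"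
      unfolding negligible_def by auto
    then have "i' \<noteq> i" using nsi i'(2)[of j] by auto
    then show ?thesis using i' unfolding negligible_def by auto
  qed
  have D_count: "countable (\<D> j)" for j
    using \<B>(1) by (rule countable_subset[rotated]) (auto simp: \<D>_def)
  have "negligible J (\<Inter>j. \<Union>(\<D> j))"
    unfolding negligible_def
  proof (intro conjI exI ballI)
    have "\<D> j \<subseteq> sets (borel_of X)" for j
      using \<B>(2) by (auto simp: \<D>_def negligible_def)
    then have "\<Union>(\<D> j) \<in> sets (borel_of X)" for j
      using D_count by (intro sets.countable_Union)
    then show "(\<Inter>j. \<Union>(\<D> j)) \<in> sets (borel_of X)"
      by (intro sets.countable_INT) auto
    fix j assume "j \<in> J i"
    have "sigma_independent X (G i j) (\<Union>(\<D> j))"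
      by (intro sigma_independent_Union D_count) (simp add: \<D>_def)
    then show "sigma_independent X (G i j) (\<Inter>j. \<Union>(\<D> j))"
      by (rule sigma_independent_mono) auto
  qed
  then have n1: "null J (\<Inter>j. \<Union>(\<D> j))" by (rule null_negligible) simp
  have n2: "null J (\<Union>j. \<Union>(\<B> j - \<D> j))"
  proof (rule null_UN)
    show "null J (\<Union>(\<B> j - \<D> j))" for j
      unfolding null_def using \<B>(1)[of j] rest by (intro exI[of _ "\<B> j - \<D> j"]) auto
  qed simp
  have "(\<Inter>j. N j) \<subseteq> (\<Inter>j. \<Union>(\<D> j)) \<union> (\<Union>j. \<Union>(\<B> j - \<D> j))"
  proof
    fix x assume "x \<in> (\<Inter>j. N j)"
    then have "x \<in> \<Union>(\<B> j)" for j using \<B>(3)[of j] by auto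
    then have "x \<in> \<Union>(\<D> j) \<or> x \<in> \<Union>(\<B> j - \<D> j)" for j by blast
    then show "x \<in> (\<Inter>j. \<Union>(\<D> j)) \<union> (\<Union>j. \<Union>(\<B> j - \<D> j))" by auto
  qed
  with null_Un[OF n1 n2] show ?thesis by (rule null_mono)
qed

text \<open>Outside a cover of \<open>range vertex\<close> no edge starts, so the remainder
  \<open>?C\<close> is independent for every graph and completes the cover of the space.\<close>

lemma null_range_vertex:
  assumes "null (\<lambda>_. UNIV) (range vertex)"
  shows "\<exists>B :: nat \<Rightarrow> 'a set. (\<forall>n. B n \<in> sets (borel_of X)) \<and> topspace X = (\<Union>n. B n) \<and>
    (\<forall>n. \<exists>i. \<forall>j. borel_chromatic_le_aleph0 (subtopology X (B n)) (restrict_graph (G i j) (B n)))"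
proof -
  obtain \<B> where \<B>: "countable \<B>" "\<And>B. B \<in> \<B> \<Longrightarrow> negligible (\<lambda>_. UNIV) B" "range vertex \<subseteq> \<Union>\<B>"
    using assms unfolding null_def by auto
  let ?C = "topspace X - \<Union>\<B>"
  have sub: "\<B> \<subseteq> sets (borel_of X)" using \<B>(2) by (auto simp: negligible_def)
  then have C: "?C \<in> sets (borel_of X)"
    using \<B>(1) by (intro borel_of_Diff_topspace sets.countable_Union)
  have "restrict_graph (G i j) ?C = {}" for i j
  proof -
    have "x \<in> \<Union>\<B>" if "(x, y) \<in> G i j" for x y
      using fst_in_range_vertex[OF that] \<B>(3) by (rule subsetD[rotated])
    then show ?thesis by (auto simp: restrict_graph_def)
  qed
  then have "sigma_independent X (G i j) ?C" for i j
    unfolding sigma_independent_def using C by (intro exI[of _ "{?C}"]) auto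
  then have C': "negligible (\<lambda>_. UNIV) ?C" using C by (simp add: negligible_def)
  define B where "B = from_nat_into (insert ?C \<B>)"
  have range_B: "range B = insert ?C \<B>"
    unfolding B_def using \<B>(1) by (intro range_from_nat_into) auto
  have B: "negligible (\<lambda>_. UNIV) (B n)" for n
    using rangeI[of B n] C' \<B>(2) unfolding range_B by auto
  have "topspace X = \<Union>(range B)"
    unfolding range_B using sub sets.sets_into_space[of _ "borel_of X"] by (auto simp: space_borel_of)
  moreover have "\<exists>i. \<forall>j. borel_chromatic_le_aleph0 (subtopology X (B n)) (restrict_graph (G i j) (B n))" for n
    using B[of n] sigma_independent_chromatic[of "B n" X] unfolding negligible_def by blast
  moreover have "B n \<in> sets (borel_of X)" for n using B[of n] by (simp add: negligible_def)
  ultimately show ?thesis by (intro exI[of _ B]) simp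
qed

end

section \<open>Configurations\<close>

text \<open>The component at \<open>(0, t)\<close> codes the vertex at \<open>t\<close>, and the component at \<open>(Suc m, t)\<close> the
  edge between the vertices at \<open>s m @ [False] @ t\<close> and \<open>s m @ [True] @ t\<close>.\<close>

type_synonym config = "nat \<times> bool list \<Rightarrow> nat \<Rightarrow> nat"

text \<open>The last bit of the index splits a stage \<open>Suc n\<close> configuration into two of
  stage \<open>n\<close>. Neither half sees components with empty index, such as
  \<open>(Suc n, [])\<close>, which codes the edge joining the halves.\<close>

definition half :: "bool \<Rightarrow> config \<Rightarrow> config" where
  "half e z = (\<lambda>c. z (fst c, snd c @ [e]))"

lemma continuous_half: "continuous_on UNIV (half e)"
  unfolding half_def[abs_def] by (rule continuous_on_reindex)

context parametrized_graphs
begin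

definition stage_small :: "nat \<Rightarrow> (nat \<Rightarrow> nat set) \<Rightarrow> config set \<Rightarrow> bool" where
  "stage_small n J \<Gamma> \<longleftrightarrow>
     (\<exists>N. null J N \<and> (\<forall>z\<in>\<Gamma>. \<exists>t. length t = n \<and> vertex (z (0, t)) \<in> N))"

lemma stage_small_UN:
  assumes "countable I" "\<And>a. a \<in> I \<Longrightarrow> stage_small n J (\<Gamma> a)"
  shows "stage_small n J (\<Union>a\<in>I. \<Gamma> a)"
proof -
  have "\<forall>a\<in>I. \<exists>N. null J N \<and> (\<forall>z\<in>\<Gamma> a. \<exists>t. length t = n \<and> vertex (z (0, t)) \<in> N)"
    using assms(2) unfolding stage_small_def by simp
  from bchoice[OF this] obtain N where
    N: "\<forall>a\<in>I. null J (N a) \<and> (\<forall>z\<in>\<Gamma> a. \<exists>t. length t = n \<and> vertex (z (0, t)) \<in> N a)" ..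
  show ?thesis unfolding stage_small_def
  proof (intro exI[of _ "\<Union>a\<in>I. N a"] conjI ballI)
    show "null J (\<Union>a\<in>I. N a)" using assms(1) N by (intro null_UN) simp_all
    fix z assume "z \<in> (\<Union>a\<in>I. \<Gamma> a)"
    then obtain a where "a \<in> I" "z \<in> \<Gamma> a" by auto
    moreover from this obtain t where "length t = n" "vertex (z (0, t)) \<in> N a"
      using bspec[OF N] by blast
    ultimately show "\<exists>t. length t = n \<and> vertex (z (0, t)) \<in> (\<Union>a\<in>I. N a)" by auto
  qed
qed

text \<open>Only finitely many \<open>t\<close> have length \<open>n\<close>, so for each
  configuration one \<open>t\<close> serves for infinitely many \<open>j\<close>, and its vertex
  lies in every tail union \<open>M j\<close>. By \<open>null_upd_mono\<close> the tail unions are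
  still null, and \<open>null_INT\<close> applies.\<close>

lemma stage_small_choose:
  assumes J: "J i = UNIV" and small: "\<And>j. stage_small n (J(i := {j})) \<Gamma>"
  shows "stage_small n J \<Gamma>"
proof -
  have "\<forall>j. \<exists>N. null (J(i := {j})) N \<and> (\<forall>z\<in>\<Gamma>. \<exists>t. length t = n \<and> vertex (z (0, t)) \<in> N)"
    using small unfolding stage_small_def by simp
  from choice[OF this] obtain N where N: "\<And>j. null (J(i := {j})) (N j)"
    "\<And>j z. z \<in> \<Gamma> \<Longrightarrow> \<exists>t. length t = n \<and> vertex (z (0, t)) \<in> N j" by auto
  define M where "M j = (\<Union>j'\<in>{j..}. N j')" for j
  have "null (J(i := {j})) (M j)" for j
    unfolding M_def using N(1) null_upd_mono by (intro null_UN) auto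
  then have null: "null J (\<Inter>j. M j)" by (rule null_INT[where J = J and i = i, OF J])
  show ?thesis unfolding stage_small_def
  proof (intro exI[of _ "\<Inter>j. M j"] conjI ballI null)
    fix z assume "z \<in> \<Gamma>"
    then have "\<forall>j. \<exists>t. length t = n \<and> vertex (z (0, t)) \<in> N j" using N(2) by simp
    from choice[OF this] obtain t :: "nat \<Rightarrow> bool list"
      where t: "\<And>j. length (t j) = n" "\<And>j. vertex (z (0, t j)) \<in> N j" by auto
    have "finite (range t)"
      by (rule finite_subset[OF _ finite_lists_length_eq[of UNIV n]]) (use t in auto)
    then obtain j where "infinite {j'. t j' = t j}"
      using pigeonhole_infinite[of UNIV t] by auto
    then have "\<exists>j''\<ge>j'. t j'' = t j" for j'
      using infinite_nat_iff_unbounded_le by auto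
    then have "vertex (z (0, t j)) \<in> M j'" for j'
      using t(2) unfolding M_def by (metis UN_iff atLeast_iff)
    then show "\<exists>t. length t = n \<and> vertex (z (0, t)) \<in> (\<Inter>j. M j)" using t(1) by blast
  qed
qed

definition link :: "nat \<Rightarrow> nat \<Rightarrow> nat \<Rightarrow> bool list \<Rightarrow> config set \<Rightarrow> config set" where
  "link n i j u \<Gamma> = {z. half False z \<in> \<Gamma> \<and> half True z \<in> \<Gamma> \<and>
     g i j (z (Suc n, [])) = (vertex (z (0, u @ [False])), vertex (z (0, u @ [True])))}"

text \<open>Equality of continuous maps into a Hausdorff space is a closed condition.\<close>

lemma link_borel:
  assumes "\<Gamma> \<in> sets borel"
  shows "link n i j u \<Gamma> \<in> sets borel"
proof -
  have coord: "continuous_map euclidean euclidean (\<lambda>z :: config. z c)" for c by simp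
  note v = continuous_map_compose[OF coord continuous_vertex]
  have cl: "closed {z :: config. (fst \<circ> g i j \<circ> (\<lambda>z. z (Suc n, []))) z = (vertex \<circ> (\<lambda>z. z (0, u @ [False]))) z}"
    (is "closed ?L")
    using closedin_continuous_maps_eq[OF Hausdorff continuous_map_compose[OF coord continuous_fst_g] v]
    by simp
  have cl': "closed {z :: config. (snd \<circ> g i j \<circ> (\<lambda>z. z (Suc n, []))) z = (vertex \<circ> (\<lambda>z. z (0, u @ [True]))) z}"
    (is "closed ?R")
    using closedin_continuous_maps_eq[OF Hausdorff continuous_map_compose[OF coord continuous_snd_g] v]
    by simp
  have half: "half e -` \<Gamma> \<in> sets borel" for e
    using measurable_sets[OF borel_measurable_continuous_onI[OF continuous_half] assms] by simp
  have "link n i j u \<Gamma> = half False -` \<Gamma> \<inter> half True -` \<Gamma> \<inter> ?L \<inter> ?R"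
    by (auto simp: link_def prod_eq_iff)
  then show ?thesis
    using sets.Int[OF sets.Int[OF sets.Int[OF half half] borel_closed[OF cl]] borel_closed[OF cl']]
    by simp
qed

text \<open>Two configurations avoiding a null set that contains a vertex of every linked pair have
  non-adjacent vertices at \<open>u\<close>; so the set of these vertices has an independent Borel hull.\<close>

lemma stage_small_link:
  assumes \<Gamma>: "\<Gamma> \<in> sets borel" and J: "J i = {j}" and u: "length u = n"
    and small: "stage_small (Suc n) J (link n i j u \<Gamma>)"
  shows "stage_small n J \<Gamma>"
proof -
  obtain N0 where N0: "null J N0" "\<And>z. z \<in> link n i j u \<Gamma> \<Longrightarrow> \<exists>t. length t = Suc n \<and> vertex (z (0, t)) \<in> N0"
    using small unfolding stage_small_def by auto
  obtain N where N: "null J N" "N \<in> sets (borel_of X)" "N0 \<subseteq> N"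
    using N0(1) by (rule null_Borel_hull)
  define T :: "bool list set" where "T = {t. length t = n}"
  \<comment> \<open>The hull \<open>N\<close> replaces \<open>N0\<close> so that
    \<open>\<Delta>\<close>, the configurations of \<open>\<Gamma>\<close> without a stage
    \<open>n\<close> vertex in \<open>N\<close>, is Borel.\<close>
  define \<Delta> where "\<Delta> = \<Gamma> - (\<Union>t\<in>T. (\<lambda>z. z (0, t)) -` vertex -` N)"
  have "\<Delta> \<in> sets borel"
  proof -
    have "(\<lambda>z. z (0, t)) -` vertex -` N \<in> sets (borel :: config measure)" for t
      using measurable_sets[OF borel_measurable_continuous_onI[OF continuous_on_product_coordinates]
          vimage_borel_of[OF continuous_vertex N(2)], of "(0, t)"] by simp
    then show ?thesis unfolding \<Delta>_def
      using \<Gamma> by (intro sets.Diff sets.countable_UN'') auto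
  qed
  let ?v = "vertex \<circ> (\<lambda>z. z (0, u))"
  let ?A = "?v ` \<Delta>"
  have "continuous_map euclidean X ?v"
    by (rule continuous_map_compose[OF _ continuous_vertex]) simp
  then have A: "suslin X ?A" using \<open>\<Delta> \<in> sets borel\<close> by (rule suslin_image)
  have "restrict_graph (range (g i j)) ?A = {}"
  proof (rule ccontr)
    assume "restrict_graph (range (g i j)) ?A \<noteq> {}"
    then obtain x y where xy: "(x, y) \<in> range (g i j)" "x \<in> ?A" "y \<in> ?A"
      unfolding restrict_graph_def by auto
    from xy(1) obtain e where e: "g i j e = (x, y)" by auto
    from xy(2) obtain z0 where z0: "z0 \<in> \<Delta>" "x = vertex (z0 (0, u))" by auto
    from xy(3) obtain z1 where z1: "z1 \<in> \<Delta>" "y = vertex (z1 (0, u))" by auto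
    \<comment> \<open>Glues \<open>z0\<close> and \<open>z1\<close> into one configuration having
      them as halves; components with empty index receive the edge code \<open>e\<close>.\<close>
    define z :: config where
      "z c = (if snd c = [] then e else (if last (snd c) then z1 else z0) (fst c, butlast (snd c)))" for c
    have half: "half False z = z0" "half True z = z1"
      by (simp_all add: half_def z_def fun_eq_iff)
    have "z0 \<in> \<Gamma>" "z1 \<in> \<Gamma>" using z0 z1 by (simp_all add: \<Delta>_def)
    moreover have "g i j (z (Suc n, [])) = (vertex (z (0, u @ [False])), vertex (z (0, u @ [True])))"
      using e z0(2) z1(2) by (simp add: z_def)
    ultimately have "z \<in> link n i j u \<Gamma>" by (simp add: link_def half)
    then obtain t where t: "length t = Suc n" "vertex (z (0, t)) \<in> N" using N0(2) N(3) by blast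
    \<comment> \<open>The vertex of \<open>z\<close> at \<open>t\<close> belongs to the half given
      by the last bit of \<open>t\<close>, and both halves avoid \<open>N\<close>.\<close>
    then have "butlast t \<in> T" "t \<noteq> []" by (auto simp: T_def)
    then have "vertex (z (0, t)) = vertex ((if last t then z1 else z0) (0, butlast t))"
      by (simp add: z_def)
    moreover have "vertex (z0 (0, butlast t)) \<notin> N" "vertex (z1 (0, butlast t)) \<notin> N"
      using z0(1) z1(1) \<open>butlast t \<in> T\<close> by (auto simp: \<Delta>_def)
    ultimately show False using t(2) by (cases "last t") simp_all
  qed
  then obtain B where B: "B \<in> sets (borel_of X)" "?A \<subseteq> B" "restrict_graph (range (g i j)) B = {}"
    by (rule independent_Borel_hull[OF Hausdorff continuous_g A])
  have "sigma_independent X (G i j) B"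
    unfolding sigma_independent_def using B(1,3) range_g[of i j] by (intro exI[of _ "{B}"]) auto
  then have "negligible J B" using B(1) J by (auto simp: negligible_def intro!: exI[of _ i])
  then have "null J (N \<union> B)" by (rule null_Un[OF N(1) null_negligible[OF _ subset_refl]])
  moreover have "\<exists>t. length t = n \<and> vertex (z (0, t)) \<in> N \<union> B" if "z \<in> \<Gamma>" for z
  proof (cases "z \<in> \<Delta>")
    case True
    then have "vertex (z (0, u)) \<in> ?A" by (intro image_eqI[of _ _ z]) simp_all
    then show ?thesis using B(2) u by blast
  next
    case False
    then show ?thesis using that by (auto simp: \<Delta>_def T_def)
  qed
  ultimately show ?thesis unfolding stage_small_def by blast
qed

text \<open>The finite set \<open>F\<close> admits only countably many assignments of
  values.\<close>

lemma stage_small_decompose: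
  fixes F :: "((nat \<times> bool list) \<times> nat) set"
  assumes "finite F" and "\<And>a. stage_small n J (\<Gamma> \<inter> {z. \<forall>(c, l)\<in>F. z c l = a (c, l)})"
  shows "stage_small n J \<Gamma>"
proof -
  have "countable (\<Pi>\<^sub>E p\<in>F. (UNIV :: nat set))" using \<open>finite F\<close> by (intro countable_PiE) auto
  then have "stage_small n J (\<Union>a\<in>\<Pi>\<^sub>E p\<in>F. UNIV. \<Gamma> \<inter> {z. \<forall>(c, l)\<in>F. z c l = a (c, l)})"
    using assms(2) by (rule stage_small_UN)
  moreover have "\<Gamma> \<subseteq> (\<Union>a\<in>\<Pi>\<^sub>E p\<in>F. UNIV. \<Gamma> \<inter> {z. \<forall>(c, l)\<in>F. z c l = a (c, l)})"
  proof
    fix z assume "z \<in> \<Gamma>"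
    then show "z \<in> (\<Union>a\<in>\<Pi>\<^sub>E p\<in>F. UNIV. \<Gamma> \<inter> {z. \<forall>(c, l)\<in>F. z c l = a (c, l)})"
      by (intro UN_I[of "restrict (\<lambda>(c, l). z c l) F"]) auto
  qed
  ultimately show ?thesis unfolding stage_small_def by (elim ex_forward conj_forward) auto
qed

text \<open>The choices are made in this order: the value \<open>j\<close> (retained if
  \<open>J i\<close> is already a singleton), the link at \<open>u\<close>, the values on
  \<open>F\<close>. None of them makes the set small.\<close>

lemma stage_step:
  assumes \<Gamma>: "\<Gamma> \<in> sets borel" "\<not> stage_small n J \<Gamma>" and J: "J i = UNIV \<or> (\<exists>j. J i = {j})"
    and u: "length u = n" and F: "finite F"
  obtains j a where "j \<in> J i"
    "\<not> stage_small (Suc n) (J(i := {j})) (link n i j u \<Gamma> \<inter> {z. \<forall>(c, l)\<in>F. z c l = a (c, l)})"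
proof -
  obtain j where j: "j \<in> J i" "\<not> stage_small n (J(i := {j})) \<Gamma>"
  proof (cases "J i = UNIV")
    case True
    then show ?thesis using that stage_small_choose[of J i n \<Gamma>] \<Gamma>(2) by auto
  next
    case False
    with J obtain j where "J i = {j}" by auto
    moreover from this have "J(i := {j}) = J" by (rule fun_upd_idem)
    ultimately show ?thesis using that[of j] \<Gamma>(2) by simp
  qed
  have "\<not> stage_small (Suc n) (J(i := {j})) (link n i j u \<Gamma>)"
    using stage_small_link[where J = "J(i := {j})" and i = i and j = j, OF \<Gamma>(1) _ u] j(2) by auto
  then obtain a where
    "\<not> stage_small (Suc n) (J(i := {j})) (link n i j u \<Gamma> \<inter> {z. \<forall>(c, l)\<in>F. z c l = a (c, l)})"
    using stage_small_decompose[OF F] by blast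
  with j(1) show thesis by (rule that)
qed

text \<open>Constant configurations realise every vertex.\<close>

lemma stage_small_UNIV:
  assumes "stage_small 0 J UNIV"
  shows "null J (range vertex)"
proof -
  obtain N where N: "null J N" "\<And>z :: config. \<exists>t. length t = 0 \<and> vertex (z (0, t)) \<in> N"
    using assms unfolding stage_small_def by auto
  have "vertex y \<in> N" for y using N(2)[of "\<lambda>_. y"] by simp
  then have "range vertex \<subseteq> N" by blast
  with N(1) show ?thesis by (rule null_mono)
qed

end

section \<open>The homomorphism\<close>

lemma tendsto_eventually_agree:
  fixes u :: "nat \<Rightarrow> nat \<Rightarrow> nat"
  assumes "\<And>d l. l \<le> d \<Longrightarrow> u d l = L l"
  shows "u \<longlonglongrightarrow> L"
proof (rule topological_tendstoI)
  fix U assume "open U" "L \<in> U"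
  then obtain n where "{y. \<forall>l<n. y l = L l} \<subseteq> U" by (rule open_contains_cylinder)
  then have "u d \<in> U" if "n \<le> d" for d using assms that by fastforce
  then show "\<forall>\<^sub>F d in sequentially. u d \<in> U" unfolding eventually_sequentially by blast
qed

text \<open>Such a map is locally constant.\<close>

lemma continuous_on_initial_segment:
  fixes F :: "bool list \<Rightarrow> 'b::topological_space"
  shows "continuous_on UNIV (\<lambda>x :: nat \<Rightarrow> bool. F (map x [0..<n]))"
proof -
  have "open ((\<lambda>x. F (map x [0..<n])) -` U)" for U
  proof (subst open_subopen, intro ballI)
    fix x assume x: "x \<in> (\<lambda>x :: nat \<Rightarrow> bool. F (map x [0..<n])) -` U"
    have "{y. \<forall>l<n. y l = x l} \<subseteq> (\<lambda>x. F (map x [0..<n])) -` U"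
    proof
      fix y assume "y \<in> {y. \<forall>l<n. y l = x l}"
      then have "map y [0..<n] = map x [0..<n]" by simp
      with x show "y \<in> (\<lambda>x. F (map x [0..<n])) -` U" by (simp only: vimage_eq)
    qed
    then show "\<exists>T. open T \<and> x \<in> T \<and> T \<subseteq> (\<lambda>x. F (map x [0..<n])) -` U"
      by (intro exI[of _ "{y. \<forall>l<n. y l = x l}"]) (simp add: open_cylinder)
  qed
  then show ?thesis by (simp add: continuous_on_open_vimage)
qed

lemma map_conc_upt: "map (u \<frown> c) [0..<length u + d] = u @ map c [0..<d]"
  by (rule nth_equalityI) (auto simp: nth_append conc_def)

context parametrized_graphs
begin

lemma continuous_homomorphism:
  fixes k :: "nat \<Rightarrow> nat" and s :: "nat \<Rightarrow> bool list"
  assumes s: "\<And>n. length (s n) = n" and nonnull: "\<not> null (\<lambda>_. UNIV) (range vertex)"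
  shows "\<exists>(f :: nat \<Rightarrow> nat) (\<phi> :: (nat \<Rightarrow> bool) \<Rightarrow> 'a). continuous_map euclidean X \<phi> \<and>
    seq_homomorphism \<phi> (GG0 k s) (\<lambda>l. G l (f l))"
proof -
  \<comment> \<open>Step \<open>n\<close> freezes positions up to \<open>n\<close> in all components
    that occur in stage \<open>Suc n\<close>.\<close>
  define F where "F n = ({..Suc n} \<times> {t :: bool list. set t \<subseteq> UNIV \<and> length t \<le> Suc n}) \<times> {..n}" for n
  have F: "finite (F n)" for n
    unfolding F_def by (intro finite_cartesian_product finite_lists_length_le) auto
  \<comment> \<open>A state is a Borel set of configurations that is not small, together with the
    record \<open>J\<close> of the values of \<open>f\<close> chosen so far.\<close>
  define P where "P n \<Gamma>J \<longleftrightarrow> fst \<Gamma>J \<in> sets borel \<and> \<not> stage_small n (snd \<Gamma>J) (fst \<Gamma>J) \<and>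
      (\<forall>i. snd \<Gamma>J i = UNIV \<or> (\<exists>j. snd \<Gamma>J i = {j}))" for n \<Gamma>J
  define Q where "Q n \<Gamma>J \<Gamma>J' \<longleftrightarrow> (\<exists>j a. j \<in> snd \<Gamma>J (k n) \<and> snd \<Gamma>J' = (snd \<Gamma>J)(k n := {j}) \<and>
      fst \<Gamma>J' = link n (k n) j (s n) (fst \<Gamma>J) \<inter> {z. \<forall>(c, l)\<in>F n. z c l = a (c, l)})" for n \<Gamma>J \<Gamma>J'
  have "\<exists>S. \<forall>n. P n (S n) \<and> Q n (S n) (S (Suc n))"
  proof (rule dependent_nat_choice)
    show "\<exists>\<Gamma>J. P 0 \<Gamma>J"
      using stage_small_UNIV[of "\<lambda>_. UNIV"] nonnull
      by (intro exI[of _ "(UNIV, \<lambda>_. UNIV)"]) (auto simp: P_def)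
  next
    fix \<Gamma>J n assume P: "P n \<Gamma>J"
    then have state: "fst \<Gamma>J \<in> sets borel" "\<not> stage_small n (snd \<Gamma>J) (fst \<Gamma>J)"
      "snd \<Gamma>J (k n) = UNIV \<or> (\<exists>j. snd \<Gamma>J (k n) = {j})" by (auto simp: P_def)
    obtain j a where ja: "j \<in> snd \<Gamma>J (k n)"
      "\<not> stage_small (Suc n) ((snd \<Gamma>J)(k n := {j}))
        (link n (k n) j (s n) (fst \<Gamma>J) \<inter> {z. \<forall>(c, l)\<in>F n. z c l = a (c, l)})"
      by (rule stage_step[OF state s F])
    let ?J = "(snd \<Gamma>J)(k n := {j})"
    let ?\<Gamma> = "link n (k n) j (s n) (fst \<Gamma>J) \<inter> {z. \<forall>(c, l)\<in>F n. z c l = a (c, l)}"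
    have "closed {z :: config. z c l = a (c, l)}" for c l
    proof -
      have "continuous_on UNIV (\<lambda>z :: config. z c l)"
        by (rule continuous_on_product_then_coordinatewise[OF continuous_on_product_coordinates])
      then have "closed ((\<lambda>z :: config. z c l) -` {a (c, l)})"
        by (rule closed_vimage[rotated]) (simp add: closed_def open_discrete)
      then show ?thesis by (simp add: vimage_def)
    qed
    then have "closed (\<Inter>p\<in>F n. {z :: config. z (fst p) (snd p) = a (fst p, snd p)})"
      by (intro closed_INT ballI)
    moreover have "(\<Inter>p\<in>F n. {z :: config. z (fst p) (snd p) = a (fst p, snd p)}) =
        {z. \<forall>(c, l)\<in>F n. z c l = a (c, l)}"
      by (auto simp: case_prod_beta)
    ultimately have "{z :: config. \<forall>(c, l)\<in>F n. z c l = a (c, l)} \<in> sets borel" by simp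
    then have "?\<Gamma> \<in> sets borel" by (rule sets.Int[OF link_borel[OF state(1)]])
    then have "P (Suc n) (?\<Gamma>, ?J)" using ja P by (simp add: P_def)
    moreover have "Q n \<Gamma>J (?\<Gamma>, ?J)" unfolding Q_def using ja(1) by (intro exI[of _ j] exI[of _ a]) simp
    ultimately show "\<exists>\<Gamma>J'. P (Suc n) \<Gamma>J' \<and> Q n \<Gamma>J \<Gamma>J'" by blast
  qed
  then obtain S where S: "\<And>n. P n (S n)" "\<And>n. Q n (S n) (S (Suc n))" by auto
  define \<Gamma> where "\<Gamma> n = fst (S n)" for n
  define J where "J n = snd (S n)" for n
  have "\<exists>j a. j \<in> J n (k n) \<and> J (Suc n) = (J n)(k n := {j}) \<and>
      \<Gamma> (Suc n) = link n (k n) j (s n) (\<Gamma> n) \<inter> {z. \<forall>(c, l)\<in>F n. z c l = a (c, l)}" for n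
    using S(2)[of n] unfolding Q_def \<Gamma>_def J_def .
  then have "\<forall>n. \<exists>j. \<exists>a. j \<in> J n (k n) \<and> J (Suc n) = (J n)(k n := {j}) \<and>
      \<Gamma> (Suc n) = link n (k n) j (s n) (\<Gamma> n) \<inter> {z. \<forall>(c, l)\<in>F n. z c l = a (c, l)}" ..
  from choice[OF this] obtain j where
    "\<forall>n. \<exists>a. j n \<in> J n (k n) \<and> J (Suc n) = (J n)(k n := {j n}) \<and>
      \<Gamma> (Suc n) = link n (k n) (j n) (s n) (\<Gamma> n) \<inter> {z. \<forall>(c, l)\<in>F n. z c l = a (c, l)}" ..
  from choice[OF this] obtain a where
    ja: "\<forall>n. j n \<in> J n (k n) \<and> J (Suc n) = (J n)(k n := {j n}) \<and>
      \<Gamma> (Suc n) = link n (k n) (j n) (s n) (\<Gamma> n) \<inter> {z. \<forall>(c, l)\<in>F n. z c l = a n (c, l)}" ..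
  have j: "j n \<in> J n (k n)" "J (Suc n) = (J n)(k n := {j n})"
    and \<Gamma>_Suc: "\<Gamma> (Suc n) = link n (k n) (j n) (s n) (\<Gamma> n) \<inter> {z. \<forall>(c, l)\<in>F n. z c l = a n (c, l)}"
    for n using spec[OF ja, of n] by - (elim conjE, assumption)+
  have half_\<Gamma>: "half e w \<in> \<Gamma> n" if "w \<in> \<Gamma> (Suc n)" for e w n
    using that unfolding \<Gamma>_Suc link_def by (cases e) auto
  have agree: "w (m, t) l = w' (m, t) l"
    if "w \<in> \<Gamma> (Suc n)" "w' \<in> \<Gamma> (Suc n)" "m \<le> Suc n" "length t \<le> Suc n" "l \<le> n" for w w' m t l n
  proof -
    have "((m, t), l) \<in> F n" using that by (simp add: F_def)
    moreover have "\<forall>(c, l)\<in>F n. w c l = a n (c, l)" "\<forall>(c, l)\<in>F n. w' c l = a n (c, l)"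
      using that(1,2) unfolding \<Gamma>_Suc by simp_all
    ultimately show ?thesis by fastforce
  qed
  have "\<Gamma> n \<noteq> {}" for n
    using S(1)[of n] null_empty[of "J n"] unfolding P_def stage_small_def \<Gamma>_def J_def by auto
  then have "\<forall>n. \<exists>w. w \<in> \<Gamma> n" by blast
  from choice[OF this] obtain z where z: "\<And>n. z n \<in> \<Gamma> n" by auto
  \<comment> \<open>A later visit to the index \<open>k m\<close> must choose from the singleton
    left by stage \<open>m\<close>.\<close>
  have J_fixed: "J (Suc m + d) (k m) = {j m}" for m d
  proof (induction d)
    case 0
    then show ?case by (simp add: j(2))
  next
    case (Suc d)
    let ?n = "Suc m + d"
    have "j ?n = j m" if "k ?n = k m" using j(1)[of ?n] unfolding that Suc by simp
    then have "((J ?n)(k ?n := {j ?n})) (k m) = {j m}" using Suc by auto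
    then show ?case unfolding add_Suc_right j(2) .
  qed
  have j_eq: "j m = j n" if "k m = k n" "m < n" for m n
  proof -
    have "J n (k m) = {j m}" using J_fixed[of m "n - Suc m"] \<open>m < n\<close> by simp
    with j(1)[of n] show ?thesis unfolding \<open>k m = k n\<close> by simp
  qed
  \<comment> \<open>The value chosen at the first visit to \<open>i\<close>; by \<open>j_eq\<close>
    later visits repeat it.\<close>
  define f where "f i = j (LEAST m. k m = i)" for i
  have f: "f (k m) = j m" for m
  proof -
    have "(LEAST m'. k m' = k m) \<le> m" by (rule Least_le) simp
    moreover have "k (LEAST m'. k m' = k m) = k m" by (rule LeastI) simp
    ultimately show ?thesis
      using j_eq[of "LEAST m'. k m' = k m" m] unfolding f_def le_less by (elim disjE) simp_all
  qed
  \<comment> \<open>Position \<open>l\<close> of the vertex code along \<open>x\<close> is frozen on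
    reaching stage \<open>Suc l\<close>, and halving carries it to all later stages.\<close>
  define \<Phi> where "\<Phi> x l = z (Suc l) (0, map x [0..<Suc l]) l" for x :: "nat \<Rightarrow> bool" and l
  have \<Phi>: "w (0, map x [0..<n]) l = \<Phi> x l" if "w \<in> \<Gamma> n" "l < n" for w x n l
    using that
  proof (induction n arbitrary: w)
    case (Suc n)
    show ?case
    proof (cases "l = n")
      case True
      then show ?thesis using agree[OF Suc.prems(1) z[of "Suc n"], of 0 "map x [0..<Suc n]" l]
        by (simp add: \<Phi>_def)
    next
      case False
      then have "half (x n) w (0, map x [0..<n]) l = \<Phi> x l"
        using Suc.prems by (intro Suc.IH half_\<Gamma>) simp_all
      then show ?thesis by (simp add: half_def)
    qed
  qed simp
  \<comment> \<open>The edge created at step \<open>m\<close>, followed along \<open>c\<close>: in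
    stage \<open>Suc (m + l)\<close> its index has length \<open>l\<close>, and position
    \<open>l\<close> is frozen since \<open>l \<le> m + l\<close>.\<close>
  define \<Psi> where "\<Psi> m c l = z (Suc (m + l)) (Suc m, map c [0..<l]) l" for m l and c :: "nat \<Rightarrow> bool"
  have \<Psi>: "w (Suc m, map c [0..<d]) l = \<Psi> m c l" if "w \<in> \<Gamma> (Suc (m + d))" "l \<le> d" for w m c d l
    using that
  proof (induction d arbitrary: w)
    case 0
    then show ?case using agree[OF 0(1) z, of "Suc m" "[]" 0] by (simp add: \<Psi>_def)
  next
    case (Suc d)
    show ?case
    proof (cases "l = Suc d")
      case True
      then show ?thesis
        using agree[OF Suc.prems(1) z[of "Suc (m + Suc d)"], of "Suc m" "map c [0..<Suc d]" l]
        by (simp add: \<Psi>_def)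
    next
      case False
      then have "half (c d) w (Suc m, map c [0..<d]) l = \<Psi> m c l"
        using Suc.prems by (intro Suc.IH half_\<Gamma>) simp_all
      then show ?thesis by (simp add: half_def)
    qed
  qed
  \<comment> \<open>Passing to halves removes the bits of \<open>t\<close> from the end, down to
    stage \<open>Suc m\<close>, where \<open>link\<close> supplies the edge.\<close>
  have edge: "g (k m) (j m) (w (Suc m, t)) = (vertex (w (0, s m @ [False] @ t)), vertex (w (0, s m @ [True] @ t)))"
    if "w \<in> \<Gamma> (Suc (m + length t))" for w m t
    using that
  proof (induction t arbitrary: w rule: rev_induct)
    case Nil
    then show ?case by (simp add: \<Gamma>_Suc link_def)
  next
    case (snoc e t)
    then have "half e w \<in> \<Gamma> (Suc (m + length t))" by (intro half_\<Gamma>) simp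
    from snoc.IH[OF this] show ?case by (simp add: half_def)
  qed
  let ?\<phi> = "vertex \<circ> \<Phi>"
  have "continuous_on UNIV \<Phi>"
    unfolding \<Phi>_def[abs_def]
    by (intro continuous_on_coordinatewise_then_product)
      (rule continuous_on_initial_segment)
  then have cont: "continuous_map euclidean X ?\<phi>"
    by (intro continuous_map_compose[OF _ continuous_vertex]) simp
  \<comment> \<open>The edge equation holds for the approximations \<open>u\<close> and
    \<open>v\<close> and passes to the limit by continuity and uniqueness of limits in
    \<open>X\<close>.\<close>
  have limit: "g (k m) (j m) (\<Psi> m c) = (?\<phi> ((s m @ [False]) \<frown> c), ?\<phi> ((s m @ [True]) \<frown> c))" for m c
  proof -
    define W where "W d = z (Suc (m + d))" for d
    have W: "W d \<in> \<Gamma> (Suc (m + d))" for d by (simp add: W_def z)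
    define u where "u d = W d (Suc m, map c [0..<d])" for d
    define v where "v e d = W d (0, s m @ [e] @ map c [0..<d])" for e d
    have uv: "g (k m) (j m) (u d) = (vertex (v False d), vertex (v True d))" for d
      unfolding u_def v_def by (rule edge) (simp add: W)
    have "u \<longlonglongrightarrow> \<Psi> m c"
      unfolding u_def by (intro tendsto_eventually_agree \<Psi> W)
    then have lim_u: "limitin euclidean u (\<Psi> m c) sequentially" by simp
    have "v e \<longlonglongrightarrow> \<Phi> ((s m @ [e]) \<frown> c)" for e
    proof (rule tendsto_eventually_agree)
      fix d l :: nat assume "l \<le> d"
      have "map ((s m @ [e]) \<frown> c) [0..<Suc (m + d)] = s m @ [e] @ map c [0..<d]"
        using map_conc_upt[of "s m @ [e]" c d] by (simp add: s)
      with \<Phi>[OF W, of l d "(s m @ [e]) \<frown> c"] \<open>l \<le> d\<close> show "v e d l = \<Phi> ((s m @ [e]) \<frown> c) l"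
        unfolding v_def by simp
    qed
    then have lim_v: "limitin X (vertex \<circ> v e) (?\<phi> ((s m @ [e]) \<frown> c)) sequentially" for e
      using continuous_map_limit[OF continuous_vertex, of "v e"] by simp
    have "fst \<circ> g (k m) (j m) \<circ> u = vertex \<circ> v False" "snd \<circ> g (k m) (j m) \<circ> u = vertex \<circ> v True"
      by (auto simp: uv)
    then have "limitin X (vertex \<circ> v False) (fst (g (k m) (j m) (\<Psi> m c))) sequentially"
      "limitin X (vertex \<circ> v True) (snd (g (k m) (j m) (\<Psi> m c))) sequentially"
      using continuous_map_limit[OF continuous_fst_g lim_u, of "k m" "j m"]
        continuous_map_limit[OF continuous_snd_g lim_u, of "k m" "j m"] by simp_all
    then have "fst (g (k m) (j m) (\<Psi> m c)) = ?\<phi> ((s m @ [False]) \<frown> c)"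
      "snd (g (k m) (j m) (\<Psi> m c)) = ?\<phi> ((s m @ [True]) \<frown> c)"
      using lim_v limitin_Hausdorff_unique[OF _ _ trivial_limit_sequentially Hausdorff] by blast+
    then show ?thesis by (simp add: prod_eq_iff)
  qed
  have "(?\<phi> x, ?\<phi> y) \<in> G i (f i)" if "(x, y) \<in> GG0 k s i" for i x y
  proof -
    from that obtain m c where m: "k m = i" "x = (s m @ [False]) \<frown> c" "y = (s m @ [True]) \<frown> c"
      unfolding GG0_def GG_node_def by auto
    have "(?\<phi> x, ?\<phi> y) \<in> G (k m) (j m)"
      unfolding range_g[symmetric] m(2,3) limit[symmetric] by (rule rangeI)
    then show ?thesis using f[of m] m(1) by simp
  qed
  then have "seq_homomorphism ?\<phi> (GG0 k s) (\<lambda>l. G l (f l))" by (simp add: seq_homomorphism_def)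
  with cont show ?thesis by (intro exI[of _ f] exI[of _ ?\<phi>] conjI)
qed

end

section \<open>The dichotomy, by reduction to nonempty graphs\<close>

theorem theorem1p1:
  fixes k :: "nat \<Rightarrow> nat"
    and s :: "nat \<Rightarrow> bool list"
    and X :: "'a topology"
    and G :: "nat \<Rightarrow> nat \<Rightarrow> ('a \<times> 'a) set"
  assumes k_0: "k 0 = 0"
    and k_Suc: "\<And>n. k (Suc n) \<le> Max {k m | m. m \<le> n} + 1"
    and k_infinite: "\<And>j. infinite {n. k n = j}"
    and s_length: "\<And>n. length (s n) = n"
    and s_dense: "\<And>j t. \<exists>n. j = k n \<and> Sublist.prefix t (s n)"
    and Hausdorff: "Hausdorff_space X"
    and analytic: "\<And>i j. analytic_graph X (G i j)"
    and increasing: "\<And>i j. G i j \<subseteq> G i (Suc j)"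
  defines "alt1 \<equiv>
      (\<exists>B :: nat \<Rightarrow> 'a set. (\<forall>n. B n \<in> sets (borel_of X)) \<and> topspace X = (\<Union>n. B n) \<and>
        (\<forall>n. \<exists>i. \<forall>j.
          borel_chromatic_le_aleph0 (subtopology X (B n)) (restrict_graph (G i j) (B n))))"
    and "alt2 \<equiv>
      (\<exists>(f :: nat \<Rightarrow> nat) (\<phi> :: (nat \<Rightarrow> bool) \<Rightarrow> 'a). continuous_map euclidean X \<phi> \<and>
        seq_homomorphism \<phi> (GG0 k s) (\<lambda>l. G l (f l)))"
  shows "(alt1 \<and> \<not> alt2) \<or> (\<not> alt1 \<and> alt2)"
proof -
  have "\<not> (alt1 \<and> alt2)"
  proof
    assume "alt1 \<and> alt2"
    then obtain B :: "nat \<Rightarrow> 'a set" and f :: "nat \<Rightarrow> nat" and \<phi> :: "(nat \<Rightarrow> bool) \<Rightarrow> 'a" where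
      h: "\<forall>n. B n \<in> sets (borel_of X)" "topspace X = (\<Union>n. B n)"
      "\<forall>n. \<exists>i. \<forall>j. borel_chromatic_le_aleph0 (subtopology X (B n)) (restrict_graph (G i j) (B n))"
      "continuous_map euclidean X \<phi>" "seq_homomorphism \<phi> (GG0 k s) (\<lambda>l. G l (f l))"
      unfolding alt1_def alt2_def by (elim conjE exE)
    show False
      by (rule alternatives_exclusive[OF s_length s_dense spec[OF h(1)] h(2) spec[OF h(3)] h(4,5)])
  qed
  moreover have "alt1 \<or> alt2"
  \<comment> \<open>If all graphs of one index are empty, the single set \<open>topspace X\<close>
    witnesses the first alternative.\<close>
  proof (cases "\<exists>i. \<forall>j. G i j = {}")
    case True
    then obtain i where "\<And>j. G i j = {}" by auto
    then have "sigma_independent X (G i j) (topspace X)" for j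
      unfolding sigma_independent_def restrict_graph_def
      by (intro exI[of _ "{topspace X}"]) (simp add: borel_of_topspace)
    then have "borel_chromatic_le_aleph0 (subtopology X (topspace X)) (restrict_graph (G i j) (topspace X))" for j
      by (intro sigma_independent_chromatic borel_of_topspace)
    then have alt1 unfolding alt1_def
      by (intro exI[of _ "\<lambda>_. topspace X"] conjI allI exI[of _ i]) (simp_all add: borel_of_topspace)
    then show ?thesis ..
  next
    case False
    then have "\<forall>i. \<exists>j. G i j \<noteq> {}" by simp
    from choice[OF this] obtain j0 where j0: "\<And>i. G i (j0 i) \<noteq> {}" by auto
    \<comment> \<open>Starting at \<open>j0 i\<close> makes all graphs nonempty, hence images of
      \<open>\<nat>\<^sup>\<nat>\<close>.\<close>
    define G' where "G' i j = G i (j0 i + j)" for i j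
    have mono: "G i j \<subseteq> G i j'" if "j \<le> j'" for i j j'
      using lift_Suc_mono_le[of "G i", OF increasing that] .
    have "\<exists>g :: (nat \<Rightarrow> nat) \<Rightarrow> 'a \<times> 'a. continuous_map euclidean (prod_topology X X) g \<and> range g = G' i j" for i j
    proof -
      have "G' i j \<noteq> {}" using j0[of i] mono[of "j0 i" "j0 i + j" i] unfolding G'_def by auto
      then show ?thesis
        using analytic[of i "j0 i + j"] unfolding analytic_graph_def analytic_in_def G'_def by simp
    qed
    then have "\<forall>p. \<exists>g :: (nat \<Rightarrow> nat) \<Rightarrow> 'a \<times> 'a. continuous_map euclidean (prod_topology X X) g \<and>
        range g = G' (fst p) (snd p)" by simp
    from choice[OF this] obtain g :: "nat \<times> nat \<Rightarrow> (nat \<Rightarrow> nat) \<Rightarrow> 'a \<times> 'a" where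
      g: "\<forall>p. continuous_map euclidean (prod_topology X X) (g p) \<and> range (g p) = G' (fst p) (snd p)" ..
    interpret parametrized_graphs X "\<lambda>i j. g (i, j)" G'
      using g increasing by unfold_locales (simp_all add: Hausdorff G'_def)
    show ?thesis
    proof (cases "null (\<lambda>_. UNIV) (range vertex)")
      case True
      from null_range_vertex[OF this] obtain B :: "nat \<Rightarrow> 'a set" where
        B: "\<forall>n. B n \<in> sets (borel_of X)" "topspace X = (\<Union>n. B n)" and
        chrom: "\<forall>n. \<exists>i. \<forall>j. borel_chromatic_le_aleph0 (subtopology X (B n)) (restrict_graph (G' i j) (B n))"
        by (elim exE conjE)
      \<comment> \<open>The shift only enlarges the graph at each \<open>j\<close>, so colourings
        for \<open>G'\<close> serve for \<open>G\<close>.\<close>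
      have sub: "restrict_graph (G i j) (B n) \<subseteq> restrict_graph (G' i j) (B n)" for i j n
        using mono[of j "j0 i + j" i] unfolding restrict_graph_def G'_def by auto
      have "\<forall>n. \<exists>i. \<forall>j. borel_chromatic_le_aleph0 (subtopology X (B n)) (restrict_graph (G i j) (B n))"
        using chrom by (elim all_forward ex_forward) (rule borel_chromatic_mono[OF _ sub])
      then have alt1 unfolding alt1_def using B by (intro exI[of _ B] conjI)
      then show ?thesis ..
    next
      case False
      from continuous_homomorphism[OF s_length this, of k]
      obtain f :: "nat \<Rightarrow> nat" and \<phi> :: "(nat \<Rightarrow> bool) \<Rightarrow> 'a" where
        "continuous_map euclidean X \<phi>" "seq_homomorphism \<phi> (GG0 k s) (\<lambda>l. G' l (f l))"
        by (elim exE conjE)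
      then have alt2 unfolding alt2_def G'_def
        by (intro exI[of _ "\<lambda>l. j0 l + f l"] exI[of _ \<phi>] conjI)
      then show ?thesis ..
    qed
  qed
  ultimately show ?thesis by blast
qed

end
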